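(* Let $\rho_S$ be a symmetric two-qubit state with spectrum $\tau_1\ge\tau_2\ge\tau_3$ (its three eigenvalues on the symmetric subspace). Then $\rho_S$ is symmetric absolutely separable if and only if $$\sqrt{\tau_2}+\sqrt{\tau_3}\ge 1.$$
   Context: Let $\mathcal H_1=\mathbb C^2$. The symmetric subspace $\mathcal H_1^{\vee 2}\subset\mathcal H_1\otimes\mathcal H_1$ is the 3-dimensional space of vectors invariant under exchange of the two qubits. A symmetric two-qubit state is a density operator (positive semidefinite, unit trace) on $\mathcal H_1\otimes\mathcal H_1$ supported on $\mathcal H_1^{\vee2}$, equivalently a density operator on $\mathcal H_1^{\vee2}\simeq\mathbb C^3$. A state is separable if it is a convex combination of projectors onto product states. $\rho_S$ is called symmetric absolutely separable (SAS) if $U_S\rho_SU_S^\dagger$ is separable for every $U_S\in SU(3)$, where $SU(3)$ is the special unitary group of $\mathcal H_1^{\vee 2}$. *)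

theory Defs
  imports "HOL-Analysis.Analysis" "HOL-Computational_Algebra.Polynomial"
begin

section \<open>Complex matrices\<close>

definition cadjoint :: "complex^'n^'m \<Rightarrow> complex^'m^'n" where
  "cadjoint A = (\<chi> i j. cnj (A $ j $ i))"

definition cinner :: "complex^'n \<Rightarrow> complex^'n \<Rightarrow> complex" where
  "cinner v w = (\<Sum>i\<in>UNIV. cnj (v $ i) * w $ i)"

definition psd :: "complex^'n^'n \<Rightarrow> bool" where
  "psd A \<longleftrightarrow> cadjoint A = A \<and> (\<forall>v. 0 \<le> Re (cinner v (A *v v)))"

definition density_operator :: "complex^'n^'n \<Rightarrow> bool" where
  "density_operator \<rho> \<longleftrightarrow> psd \<rho> \<and> trace \<rho> = 1"

definition projector :: "complex^'n \<Rightarrow> complex^'n^'n" where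
  "projector v = (\<chi> i j. v $ i * cnj (v $ j))"

definition special_unitary :: "(complex^'n^'n) set" where
  "special_unitary = {U. cadjoint U ** U = mat 1 \<and> det U = 1}"

definition charpoly :: "complex^'n^'n \<Rightarrow> complex poly" where
  "charpoly A = det (\<chi> i j. (if i = j then [:0, 1:] else 0) - [:A $ i $ j:])"

text \<open>The eigenvalues, counted with algebraic multiplicity.\<close>

definition eigenvalues :: "complex^'n^'n \<Rightarrow> complex multiset" where
  "eigenvalues A = proots (charpoly A)"


section \<open>Two qubits and the symmetric subspace\<close>

text \<open>
  The space \<open>\<complex>\<^sup>2 \<otimes> \<complex>\<^sup>2\<close> is \<open>complex ^ (2 \<times> 2)\<close>: the
  coordinate at \<open>(i, j)\<close> is the coefficient of the product basis vector
  \<open>e\<^sub>i \<otimes> e\<^sub>j\<close>. The two elements of the index type \<open>2\<close> are \<open>1\<close> and \<open>2\<close>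
  (with \<open>2 = 0\<close>).
\<close>

type_synonym two_qubit_vec = "complex ^ (2 \<times> 2)"
type_synonym two_qubit_op = "complex ^ (2 \<times> 2) ^ (2 \<times> 2)"

definition tensor :: "complex^2 \<Rightarrow> complex^2 \<Rightarrow> two_qubit_vec" where
  "tensor a b = (\<chi> p. a $ fst p * b $ snd p)"

definition sym_subspace :: "two_qubit_vec set" where
  "sym_subspace = {v. \<forall>i j. v $ (i, j) = v $ (j, i)}"

definition symmetric_state :: "two_qubit_op \<Rightarrow> bool" where
  "symmetric_state \<rho> \<longleftrightarrow> density_operator \<rho> \<and> (\<forall>v. \<rho> *v v \<in> sym_subspace)"

definition separable :: "two_qubit_op \<Rightarrow> bool" where
  "separable \<rho> \<longleftrightarrow> \<rho> \<in> convex hull {projector (tensor a b) | a b. norm a = 1 \<and> norm b = 1}"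

text \<open>
  An orthonormal basis of the symmetric subspace, arranged as the columns of an
  isometry from \<open>\<complex>\<^sup>3\<close> into \<open>\<complex>\<^sup>2 \<otimes> \<complex>\<^sup>2\<close>, identifies operators
  on the symmetric subspace with 3 by 3 matrices.  Neither the spectrum on the
  symmetric subspace nor the set of all lifted special unitaries depends on the
  choice of this basis.
\<close>

definition dicke :: "3 \<Rightarrow> two_qubit_vec" where
  "dicke k =
    (if k = 1 then tensor (axis 1 1) (axis 1 1)
     else if k = 2 then
       (1 / sqrt 2) *\<^sub>R (tensor (axis 1 1) (axis 2 1) + tensor (axis 2 1) (axis 1 1))
     else tensor (axis 2 1) (axis 2 1))"

definition sym_iso :: "complex ^ 3 ^ (2 \<times> 2)" where
  "sym_iso = (\<chi> p k. dicke k $ p)"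

definition sym_restrict :: "two_qubit_op \<Rightarrow> complex^3^3" where
  "sym_restrict A = cadjoint sym_iso ** A ** sym_iso"

definition sym_lift :: "complex^3^3 \<Rightarrow> two_qubit_op" where
  "sym_lift U = sym_iso ** U ** cadjoint sym_iso"

definition symmetric_absolutely_separable :: "two_qubit_op \<Rightarrow> bool" where
  "symmetric_absolutely_separable \<rho> \<longleftrightarrow>
    (\<forall>U\<in>special_unitary. separable (sym_lift U ** \<rho> ** cadjoint (sym_lift U)))"

lemma sum_two_two: "(\<Sum>p\<in>UNIV. f p) = f (1,1) + f (1,2) + f (2,1) + f (2,2)"
  for f :: "2 \<times> 2 \<Rightarrow> 'a::comm_monoid_add"
proof -
  have "(\<Sum>p\<in>UNIV. f p) = (\<Sum>i\<in>UNIV. \<Sum>j\<in>UNIV. f (i, j))"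
    by (simp add: sum.cartesian_product flip: UNIV_Times_UNIV)
  then show ?thesis by (simp add: sum_2 add_ac)
qed

lemma sym_iso_isometry: "cadjoint sym_iso ** sym_iso = mat 1"
proof -
  have [simp]: "complex_of_real (sqrt 2) * complex_of_real (sqrt 2) = 2"
    by (simp flip: of_real_mult)
  show ?thesis
    by (simp add: vec_eq_iff matrix_matrix_mult_def cadjoint_def sym_iso_def dicke_def
        tensor_def axis_def mat_def sum_two_two forall_3
        scaleR_conv_of_real[where 'a = complex])
qed

lemma range_sym_iso: "range ((*v) sym_iso) = sym_subspace"
proof
  show "range ((*v) sym_iso) \<subseteq> sym_subspace"
    by (auto simp: sym_subspace_def matrix_vector_mult_def sym_iso_def dicke_def
        tensor_def axis_def sum_3 forall_2)
next
  show "sym_subspace \<subseteq> range ((*v) sym_iso)"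
  proof
    fix v assume "v \<in> sym_subspace"
    then have v: "v $ (2, 1) = v $ (1, 2)"
      unfolding sym_subspace_def by blast
    define w :: "complex^3" where
      "w = vector [v $ (1, 1), complex_of_real (sqrt 2) * v $ (1, 2), v $ (2, 2)]"
    have "v $ (i, j) = (sym_iso *v w) $ (i, j)" for i j
      using exhaust_2[of i] exhaust_2[of j]
      by (auto simp: v matrix_vector_mult_def sym_iso_def dicke_def
          tensor_def axis_def sum_3 w_def scaleR_conv_of_real[where 'a = complex])
    then have "v = sym_iso *v w"
      by (simp add: vec_eq_iff split_paired_all)
    then show "v \<in> range ((*v) sym_iso)" by blast
  qed
qed

end

theory Submission
  imports Defs
begin

text \<open>
  Write \<open>P n = (1 + n \<cdot> \<sigma>) / 2\<close> for the pure qubit state with Bloch vector \<open>n\<close>.  A symmetric state is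
  \<open>(1 / 4) \<Sum> M\<^bsub>\<mu>\<nu>\<^esub> \<sigma>\<^sub>\<mu> \<otimes> \<sigma>\<^sub>\<nu>\<close> for a real symmetric matrix \<open>M\<close> with \<open>M\<^sub>0\<^sub>0 = 1\<close>, vector part \<open>r\<close> and
  spatial part \<open>N\<close> of trace 1, and it equals \<open>P n \<otimes> P n\<close> iff \<open>M\<close> has \<open>r = n\<close>, \<open>N = n n\<^sup>T\<close>.  The convex
  hull of the pairs \<open>(n n\<^sup>T, n)\<close> is \<open>{(N, r). tr N = 1, r r\<^sup>T \<le> N}\<close>: if an extreme point had
  \<open>norm r < 1\<close>, the line from \<open>r\<close> in a direction of the range of \<open>N - r r\<^sup>T\<close> would meet the sphere
  in some \<open>n\<close>, and a small multiple of \<open>(n n\<^sup>T, n)\<close> could be split off.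

  For a unit vector \<open>n\<close> let \<open>x, y, z\<close> be the expectations of the state in the spin-1 basis adapted
  to \<open>n\<close>.  Then \<open>r \<cdot> n = x - z\<close> and \<open>n \<cdot> N n = x + z - y\<close>, so that \<open>r r\<^sup>T \<le> N\<close> says \<open>y\<^sup>2 \<le> 4 x z\<close> for all
  \<open>n\<close>.  The expectations lie between the extreme eigenvalues and sum to 1; hence \<open>y \<le> \<tau>\<^sub>1\<close> and
  \<open>x z \<ge> \<tau>\<^sub>2 \<tau>\<^sub>3\<close>, and \<open>\<tau>\<^sub>1\<^sup>2 \<le> 4 \<tau>\<^sub>2 \<tau>\<^sub>3\<close>, which is \<open>1 \<le> sqrt \<tau>\<^sub>2 + sqrt \<tau>\<^sub>3\<close>, suffices.  Conversely,
  rotating the state to \<open>diag (\<tau>\<^sub>3, \<tau>\<^sub>1, \<tau>\<^sub>2)\<close> in the Dicke basis, positivity of its partial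
  transpose gives the same inequality.
\<close>

section \<open>Second moments of measures on the sphere\<close>

definition outer :: "real^'n \<Rightarrow> real^'n^'n" where
  "outer n = (\<chi> i j. n $ i * n $ j)"

text \<open>These are the second and first moments of probability measures on the unit sphere. The
  inequality says that the covariance N - r r^T is positive semidefinite, and the trace is the mean
  squared length.\<close>

definition sphere_moments :: "((real^'n^'n) \<times> (real^'n)) set" where
  "sphere_moments = {(N, r). transpose N = N \<and> trace N = 1 \<and> (\<forall>y. (r \<bullet> y)\<^sup>2 \<le> y \<bullet> (N *v y))}"

lemma outer_mult_vec: "outer n *v y = (n \<bullet> y) *\<^sub>R n"
  by (simp add: outer_def vec_eq_iff matrix_vector_mult_def inner_vec_def sum_distrib_left mult_ac)

lemma trace_outer: "trace (outer n) = n \<bullet> n"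
  by (simp add: outer_def trace_def inner_vec_def)

lemma transpose_outer: "transpose (outer n) = outer n"
  by (simp add: outer_def transpose_def vec_eq_iff mult.commute)

lemma inner_mult_vec_commute:
  fixes N :: "real^'n^'n"
  assumes "transpose N = N"
  shows "u \<bullet> (N *v v) = v \<bullet> (N *v u)"
  using dot_lmul_matrix[of u N v] assms by (metis inner_commute transpose_matrix_vector)

lemma convex_sphere_moments: "convex sphere_moments"
proof (rule convexI)
  fix p q :: "(real^'n^'n) \<times> (real^'n)" and u v :: real
  assume pq: "p \<in> sphere_moments" "q \<in> sphere_moments" and uv: "0 \<le> u" "0 \<le> v" "u + v = 1"
  obtain N r where p: "p = (N, r)" by (cases p)
  obtain M s where q: "q = (M, s)" by (cases q)
  have "((u *\<^sub>R r + v *\<^sub>R s) \<bullet> y)\<^sup>2 \<le> y \<bullet> ((u *\<^sub>R N + v *\<^sub>R M) *v y)" for y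
  proof -
    \<comment> \<open>Since \<open>u + v = 1\<close>, the square of the mean is the mean of the
      squares minus the variance
      \<open>u * v * (r \<bullet> y - s \<bullet> y)\<^sup>2\<close>.\<close>
    have "((u *\<^sub>R r + v *\<^sub>R s) \<bullet> y)\<^sup>2 = u * (r \<bullet> y)\<^sup>2 + v * (s \<bullet> y)\<^sup>2 - u * v * (r \<bullet> y - s \<bullet> y)\<^sup>2"
    proof -
      have v: "v = 1 - u" using uv by simp
      show ?thesis unfolding v
        by (simp add: inner_add_left power2_eq_square algebra_simps)
    qed
    also have "\<dots> \<le> u * (y \<bullet> (N *v y)) + v * (y \<bullet> (M *v y))"
    proof -
      have "u * (r \<bullet> y)\<^sup>2 \<le> u * (y \<bullet> (N *v y))" "v * (s \<bullet> y)\<^sup>2 \<le> v * (y \<bullet> (M *v y))"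
        using pq uv by (auto simp: p q sphere_moments_def intro!: mult_left_mono)
      moreover have "0 \<le> u * v * (r \<bullet> y - s \<bullet> y)\<^sup>2" using uv by simp
      ultimately show ?thesis by linarith
    qed
    also have "\<dots> = y \<bullet> ((u *\<^sub>R N + v *\<^sub>R M) *v y)"
      by (simp add: matrix_vector_mult_add_rdistrib inner_add_right scaleR_matrix_vector_assoc[symmetric])
    finally show ?thesis .
  qed
  moreover have "transpose (u *\<^sub>R N + v *\<^sub>R M) = u *\<^sub>R N + v *\<^sub>R M"
    using pq by (simp add: p q sphere_moments_def transpose_def vec_eq_iff)
  moreover have "trace (u *\<^sub>R N + v *\<^sub>R M) = 1"
    using pq uv by (simp add: p q sphere_moments_def trace_def sum.distrib flip: sum_distrib_left)
  ultimately show "u *\<^sub>R p + v *\<^sub>R q \<in> sphere_moments"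
    by (simp add: p q sphere_moments_def)
qed

text \<open>All conditions are closed. The trace bounds \<open>r\<close> and the diagonal of
  \<open>N\<close>, and positivity at sums and differences of two axes bounds the remaining entries
  by the diagonal.\<close>

lemma compact_sphere_moments: "compact (sphere_moments :: ((real^'n^'n) \<times> (real^'n)) set)"
proof -
  have "sphere_moments =
      {p :: (real^'n^'n) \<times> (real^'n). \<forall>i j. fst p $ j $ i = fst p $ i $ j} \<inter>
      {p. (\<Sum>i\<in>UNIV. fst p $ i $ i) = 1} \<inter>
      {p. \<forall>y. (snd p \<bullet> y)\<^sup>2 \<le> (\<Sum>i\<in>UNIV. y $ i * (\<Sum>j\<in>UNIV. fst p $ i $ j * y $ j))}"
    by (auto simp: sphere_moments_def transpose_def vec_eq_iff trace_def inner_vec_def matrix_vector_mult_def)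
  moreover have "closed \<dots>"
    by (intro closed_Int closed_Collect_all closed_Collect_eq closed_Collect_le continuous_intros)
  ultimately have "closed (sphere_moments :: ((real^'n^'n) \<times> (real^'n)) set)" by (simp only:)
  moreover have "norm p \<le> real CARD('n) * real CARD('n) + 1"
    if "p \<in> sphere_moments" for p :: "(real^'n^'n) \<times> (real^'n)"
  proof -
    obtain N r where p: "p = (N, r)" by (cases p)
    have sym: "N $ j $ i = N $ i $ j" for i j
      using that by (auto simp: p sphere_moments_def transpose_def vec_eq_iff)
    have tr: "(\<Sum>i\<in>UNIV. N $ i $ i) = 1"
      using that by (simp add: p sphere_moments_def trace_def)
    have pos: "(r \<bullet> y)\<^sup>2 \<le> y \<bullet> (N *v y)" for y
      using that by (simp add: p sphere_moments_def)
    have pos0: "0 \<le> y \<bullet> (N *v y)" for y using pos[of y] zero_le_power2 order_trans by blast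
    have ent: "axis i 1 \<bullet> (N *v axis j 1) = N $ i $ j" for i j
      by (simp add: inner_axis' matrix_vector_mult_basis column_def)
    have ri: "(r $ i)\<^sup>2 \<le> N $ i $ i" for i
      using pos[of "axis i 1"] by (simp add: ent inner_axis)
    have "(\<Sum>i\<in>UNIV. (r $ i)\<^sup>2) \<le> 1"
      using sum_mono[of UNIV "\<lambda>i. (r $ i)\<^sup>2" "\<lambda>i. N $ i $ i"] ri tr by simp
    then have r1: "norm r \<le> 1"
      by (simp add: norm_vec_def L2_set_def)
    have d0: "0 \<le> N $ i $ i" for i using ri[of i] zero_le_power2 order_trans by blast
    have d1: "N $ i $ i \<le> 1" for i
      using member_le_sum[of i UNIV "\<lambda>i. N $ i $ i"] d0 tr by simp
    have "\<bar>N $ i $ j\<bar> \<le> 1" for i j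
      using pos0[of "axis i 1 + axis j 1"] pos0[of "axis i 1 - axis j 1"] d1[of i] d1[of j]
      by (simp add: matrix_vector_right_distrib matrix_vector_mult_diff_distrib inner_add inner_diff ent sym[of i j])
    then have "norm (N $ i) \<le> real CARD('n)" for i
      by (intro order_trans[OF norm_le_l1_cart] order_trans[OF sum_bounded_above[where K = 1]]) simp_all
    then have "norm N \<le> real CARD('n) * real CARD('n)"
      unfolding norm_vec_def[of N]
      by (intro order_trans[OF L2_set_le_sum] order_trans[OF sum_bounded_above[where K = "real CARD('n)"]]) simp_all
    then show ?thesis using norm_Pair_le[of N r] r1 by (simp add: p)
  qed
  ultimately show ?thesis by (metis compact_eq_bounded_closed bounded_iff)
qed

section \<open>Extreme points of the moment set\<close>

lemma psd_cauchy_schwarz: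
  fixes D :: "real^'n^'n"
  assumes sym: "transpose D = D" and pos: "\<And>u. 0 \<le> u \<bullet> (D *v u)"
  shows "(u \<bullet> (D *v v))\<^sup>2 \<le> (u \<bullet> (D *v u)) * (v \<bullet> (D *v v))"
proof -
  have *: "0 \<le> u \<bullet> (D *v u) + 2 * t * (u \<bullet> (D *v v)) + t\<^sup>2 * (v \<bullet> (D *v v))" for t
    using pos[of "u + t *\<^sub>R v"] inner_mult_vec_commute[OF sym, of v u]
    by (simp add: matrix_vector_right_distrib matrix_vector_mult_scaleR inner_add power2_eq_square algebra_simps)
  show ?thesis
  proof (cases "v \<bullet> (D *v v) = 0")
    case True
    have "u \<bullet> (D *v v) = 0"
    proof (rule ccontr)
      assume "u \<bullet> (D *v v) \<noteq> 0"
      \<comment> \<open>Without a quadratic term the polynomial in \<open>t\<close> is affine; at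
        this \<open>t\<close> its value is -1.\<close>
      then show False
        using *[of "- (u \<bullet> (D *v u) + 1) / (2 * (u \<bullet> (D *v v)))"] pos[of u]
        by (simp add: True field_simps)
    qed
    then show ?thesis by (simp add: True)
  next
    case False
    then have v: "v \<bullet> (D *v v) > 0" using pos[of v] by simp
    \<comment> \<open>\<open>t\<close> is chosen as the minimiser of the quadratic
      polynomial.\<close>
    have "0 \<le> u \<bullet> (D *v u) - (u \<bullet> (D *v v))\<^sup>2 / (v \<bullet> (D *v v))"
      using *[of "- (u \<bullet> (D *v v)) / (v \<bullet> (D *v v))"] v
      by (simp add: power2_eq_square field_simps)
    then show ?thesis using v by (simp add: field_simps)
  qed
qed

lemma line_meets_sphere:
  fixes r w :: "'a::real_inner"
  assumes r: "norm r < 1" and w: "w \<noteq> 0"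
  obtains k where "norm (r + k *\<^sub>R w) = 1"
proof -
  let ?f = "\<lambda>k. norm (r + k *\<^sub>R w)"
  \<comment> \<open>At this \<open>k\<close> the added vector has length 2, so the sum lies outside
    the ball; the intermediate value theorem finishes.\<close>
  have "1 \<le> ?f (2 / norm w)"
    using norm_triangle_ineq2[of "(2 / norm w) *\<^sub>R w" "- r"] r w by (simp add: add.commute)
  moreover have "continuous_on {0..2 / norm w} ?f" by (intro continuous_intros)
  ultimately show ?thesis
    using IVT'[of ?f 0 1 "2 / norm w"] r that by auto
qed

text \<open>If the covariance \<open>D\<close> vanishes, so does its trace
  \<open>1 - (norm r)\<^sup>2\<close>. Otherwise a point mass of weight \<open>l\<close> on the
  sphere can be split off, contradicting extremality.\<close>

lemma extreme_sphere_moments: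
  assumes "(N, r) extreme_point_of sphere_moments"
  shows "norm r = 1 \<and> N = outer r"
proof -
  have mem: "(N, r) \<in> sphere_moments" using assms by (simp add: extreme_point_of_def)
  define D where "D = N - outer r"
  have symD: "transpose D = D"
    using mem by (simp add: D_def sphere_moments_def transpose_def vec_eq_iff outer_def)
  have formD: "u \<bullet> (D *v u) = u \<bullet> (N *v u) - (r \<bullet> u)\<^sup>2" for u
    by (simp add: D_def matrix_vector_mult_diff_rdistrib outer_mult_vec inner_diff_right
        power2_eq_square inner_commute)
  have posD: "0 \<le> u \<bullet> (D *v u)" for u
    using mem by (simp add: formD sphere_moments_def)
  note cs = psd_cauchy_schwarz[OF symD posD]
  have traceD: "trace D = 1 - (norm r)\<^sup>2"
    using mem by (simp add: D_def sphere_moments_def trace_sub trace_outer power2_norm_eq_inner)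
  have diagD: "axis i 1 \<bullet> (D *v axis i 1) = D $ i $ i" for i
    by (simp add: inner_axis' matrix_vector_mult_basis column_def)
  have diag0: "0 \<le> D $ i $ i" for i using posD[of "axis i 1"] by (simp only: diagD)
  then have trace0: "0 \<le> trace D" by (simp add: trace_def sum_nonneg)
  then have "(norm r)\<^sup>2 \<le> 1" by (simp add: traceD)
  then have r1: "norm r \<le> 1" by (simp add: power_le_one_iff abs_square_le_1)
  show ?thesis
  proof (cases "D = 0")
    case True
    then have "(norm r)\<^sup>2 = 1" using traceD by (simp add: trace_def)
    moreover have "N = outer r" using True by (simp add: D_def)
    ultimately show ?thesis by (simp add: power2_eq_1_iff) 
       (metis norm_ge_zero not_one_le_zero neg_0_le_iff_le)
  next
    case False
    then obtain y where y: "D *v y \<noteq> 0" by (metis matrix_eq matrix_vector_mult_0)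
    \<comment> \<open>If the form vanished at \<open>y\<close>, Cauchy-Schwarz against
      \<open>D *v y\<close> would force \<open>D *v y = 0\<close>.\<close>
    have c: "0 < y \<bullet> (D *v y)"
      using cs[of "D *v y" y] posD[of y] y by (metis inner_eq_zero_iff less_eq_real_def mult_zero_right not_less
          power2_less_eq_zero_iff)
    have "norm r \<noteq> 1"
    proof
      assume "norm r = 1"
      then have "trace D = 0" by (simp add: traceD)
      then have z: "D $ i $ i = 0" for i
        using sum_nonneg_eq_0_iff[of UNIV "\<lambda>i. D $ i $ i"] diag0 by (simp add: trace_def)
      have "u \<bullet> (D *v axis i 1) = 0" for u i
        using cs[of u "axis i 1"] by (simp add: diagD z)
      then have "D *v axis i 1 = 0" for i by (metis inner_eq_zero_iff)
      then have "D = 0" by (simp add: matrix_vector_mult_basis column_def vec_eq_iff)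
      then show False using False by simp
    qed
    then have r: "norm r < 1" using r1 by force
    obtain k where n: "norm (r + k *\<^sub>R (D *v y)) = 1" using line_meets_sphere[OF r y] .
    define n where "n = r + k *\<^sub>R (D *v y)"
    have n1: "n \<bullet> n = 1" using n by (simp add: n_def norm_eq_1)
    \<comment> \<open>The weight \<open>l\<close> meets the two bounds needed in \<open>key\<close>:
      \<open>2 * l \<le> 1\<close> for the square of the mean and \<open>l2\<close> for the
      covariance term.\<close>
    define l where "l = min (1/2) (1 / (2 * (k\<^sup>2 * (y \<bullet> (D *v y)) + 1)))"
    have den: "0 < k\<^sup>2 * (y \<bullet> (D *v y)) + 1"
      using c by (meson add_nonneg_pos less_imp_le mult_nonneg_nonneg zero_le_power2 zero_less_one)
    have l: "0 < l" "l \<le> 1/2" using den by (auto simp: l_def)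
    have "l \<le> 1 / (2 * (k\<^sup>2 * (y \<bullet> (D *v y)) + 1))" by (simp add: l_def)
    then have "l * (2 * (k\<^sup>2 * (y \<bullet> (D *v y)) + 1)) \<le> 1" using den by (simp add: pos_le_divide_eq)
    then have l2: "2 * l * (k\<^sup>2 * (y \<bullet> (D *v y))) \<le> 1" using l by (simp add: algebra_simps)
    \<comment> \<open>With \<open>u0\<close> as homogenizing coordinate, this says that
      \<open>l\<close> times the full moment matrix of the point mass at \<open>n\<close> lies below
      that of \<open>(N, r)\<close>.\<close>
    have key: "l * (u0 + n \<bullet> u)\<^sup>2 \<le> (u0 + r \<bullet> u)\<^sup>2 + u \<bullet> (D *v u)" for u0 u
    proof -
      define a b where "a = u0 + r \<bullet> u" and "b = u \<bullet> (D *v y)"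
      have ab: "u0 + n \<bullet> u = a + k * b"
        by (simp add: a_def b_def n_def inner_add_left inner_commute[of "D *v y" u])
      have "(a + k * b)\<^sup>2 \<le> 2 * a\<^sup>2 + 2 * (k\<^sup>2 * b\<^sup>2)"
        using zero_le_power2[of "a - k * b"] by (simp add: power2_eq_square algebra_simps)
      then have "l * (a + k * b)\<^sup>2 \<le> l * (2 * a\<^sup>2 + 2 * (k\<^sup>2 * b\<^sup>2))"
        using l by (simp add: mult_left_mono)
      also have "\<dots> = (2 * l) * a\<^sup>2 + 2 * l * k\<^sup>2 * b\<^sup>2" by (simp add: algebra_simps)
      also have "\<dots> \<le> 1 * a\<^sup>2 + 2 * l * k\<^sup>2 * ((u \<bullet> (D *v u)) * (y \<bullet> (D *v y)))"
        using l cs[of u y] by (intro add_mono mult_right_mono mult_left_mono) (auto simp: b_def)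
      also have "\<dots> = a\<^sup>2 + (2 * l * (k\<^sup>2 * (y \<bullet> (D *v y)))) * (u \<bullet> (D *v u))" by (simp add: algebra_simps)
      also have "\<dots> \<le> a\<^sup>2 + 1 * (u \<bullet> (D *v u))"
        using l2 posD[of u] by (intro add_left_mono mult_right_mono) auto
      finally show ?thesis by (simp add: ab a_def)
    qed
    \<comment> \<open>What remains after the point mass is removed, renormalized to total mass
      1.\<close>
    define N' r' where "N' = (1 / (1 - l)) *\<^sub>R (N - l *\<^sub>R outer n)" and "r' = (1 / (1 - l)) *\<^sub>R (r - l *\<^sub>R n)"
    have l1: "0 < 1 - l" using l by simp
    have "(r' \<bullet> u)\<^sup>2 \<le> u \<bullet> (N' *v u)" for u
    proof -
      define a b c where "a = r \<bullet> u" and "b = n \<bullet> u" and "c = u \<bullet> (N *v u)"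
      define q where "q = (a - l * b) / (1 - l)"
      have q: "a - l * b = q * (1 - l)" using l1 by (simp add: q_def)
      have r'u: "r' \<bullet> u = q" by (simp add: r'_def q_def a_def b_def inner_diff_left)
      have N'u: "u \<bullet> (N' *v u) = (c - l * b\<^sup>2) / (1 - l)"
        by (simp add: N'_def c_def b_def scaleR_matrix_vector_assoc[symmetric]
            matrix_vector_mult_diff_rdistrib outer_mult_vec inner_diff_right
            power2_eq_square inner_commute)
      \<comment> \<open>The choice \<open>u0 = - (r' \<bullet> u)\<close> turns the homogeneous form
        of the remainder into its covariance.\<close>
      have "l * (- q + b)\<^sup>2 \<le> (- q + a)\<^sup>2 + (c - a\<^sup>2)"
        using key[of "- q" u] by (simp add: formD a_def b_def c_def)
      then have "(2 * q) * (a - l * b) - (1 - l) * q\<^sup>2 \<le> c - l * b\<^sup>2"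
        by (simp add: power2_eq_square algebra_simps)
      then have "(1 - l) * q\<^sup>2 \<le> c - l * b\<^sup>2"
        unfolding q by (simp add: power2_eq_square algebra_simps)
      then show ?thesis using l1 by (simp add: r'u N'u pos_le_divide_eq mult.commute)
    qed
    moreover have "transpose N' = N'"
      using mem by (simp add: N'_def sphere_moments_def transpose_def vec_eq_iff outer_def mult.commute)
    moreover have "trace N' = 1"
    proof -
      have "trace N' = (trace N - l * trace (outer n)) / (1 - l)"
        by (simp add: N'_def trace_def sum_subtractf sum_distrib_left sum_divide_distrib diff_divide_distrib)
      then show ?thesis using mem l1 by (simp add: sphere_moments_def trace_outer n1)
    qed
    ultimately have mem': "(N', r') \<in> sphere_moments" by (simp add: sphere_moments_def)
    have memn: "(outer n, n) \<in> sphere_moments"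
      by (simp add: sphere_moments_def transpose_outer trace_outer n1 outer_mult_vec
          power2_eq_square inner_commute)
    have eq: "(N, r) = (1 - l) *\<^sub>R (N', r') + l *\<^sub>R (outer n, n)"
      using l1 by (simp add: N'_def r'_def)
    have "r \<noteq> n" using r n by (auto simp: n_def)
    have "(N', r') \<noteq> (outer n, n)"
    proof
      assume "(N', r') = (outer n, n)"
      then have "(N, r) = (outer n, n)" using eq by (simp add: scaleR_left_diff_distrib)
      then show False using \<open>r \<noteq> n\<close> by simp
    qed
    then have "(N, r) \<in> open_segment (N', r') (outer n, n)"
      using eq l by (auto simp: in_segment intro!: exI[of _ l])
    then show ?thesis using assms mem' memn by (simp add: extreme_point_of_def)
  qed
qed

text \<open>By Minkowski's theorem a compact convex set is the hull of its extreme points, which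
  here are moments of point masses.\<close>

lemma sphere_moments_subset_hull:
  "sphere_moments \<subseteq> convex hull {(outer n, n) |n. norm n = 1}"
proof -
  have "sphere_moments = convex hull {p. p extreme_point_of sphere_moments}"
    by (rule Krein_Milman_Minkowski[OF compact_sphere_moments convex_sphere_moments])
  also have "\<dots> \<subseteq> convex hull {(outer n, n) |n. norm n = 1}"
    by (rule hull_mono) (auto dest!: extreme_sphere_moments)
  finally show ?thesis .
qed

section \<open>Bloch vectors and Pauli matrices\<close>

text \<open>The four products are the entries of P n. The first coordinate of the spinor is taken
  real and positive, which fails only at the south pole \<open>n $ 3 = -1\<close>; there the second
  basis vector is used.\<close>

lemma bloch_spinor:
  fixes n :: "real^3"
  assumes n: "norm n = 1"
  obtains b :: "complex^2" where "norm b = 1"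
    "b $ 1 * cnj (b $ 1) = of_real ((1 + n $ 3) / 2)"
    "b $ 1 * cnj (b $ 2) = Complex (n $ 1 / 2) (- (n $ 2 / 2))"
    "b $ 2 * cnj (b $ 1) = Complex (n $ 1 / 2) (n $ 2 / 2)"
    "b $ 2 * cnj (b $ 2) = of_real ((1 - n $ 3) / 2)"
proof -
  have sq: "(n $ 1)\<^sup>2 + (n $ 2)\<^sup>2 + (n $ 3)\<^sup>2 = 1"
    using n by (simp add: norm_eq_1 inner_vec_def sum_3 power2_eq_square)
  have norm1: "norm b = 1" if "(cmod (b $ 1))\<^sup>2 + (cmod (b $ 2))\<^sup>2 = 1" for b :: "complex^2"
    using that by (simp add: norm_vec_def L2_set_def sum_2)
  have "(n $ 3)\<^sup>2 \<le> 1" using sq by (smt (verit) zero_le_power2)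
  then have n3: "\<bar>n $ 3\<bar> \<le> 1" by (simp add: abs_square_le_1)
  show thesis
  proof (cases "n $ 3 = -1")
    case True
    then have "n $ 1 = 0" "n $ 2 = 0" using sq by (auto simp: sum_power2_eq_zero_iff)
    then show thesis
      using True by (intro that[of "axis 2 1"] norm1) (auto simp: axis_def complex_eq_iff)
  next
    case False
    define s where "s = sqrt ((1 + n $ 3) / 2)"
    have s2: "s\<^sup>2 = (1 + n $ 3) / 2" and s0: "s > 0" using False n3 by (auto simp: s_def)
    define b :: "complex^2" where "b = vector [of_real s, Complex (n $ 1 / (2 * s)) (n $ 2 / (2 * s))]"
    have e: "(n $ 1 / (2 * s))\<^sup>2 + (n $ 2 / (2 * s))\<^sup>2 = (1 - n $ 3) / 2"
    proof -
      have "(n $ 1 / (2 * s))\<^sup>2 + (n $ 2 / (2 * s))\<^sup>2 = ((n $ 1)\<^sup>2 + (n $ 2)\<^sup>2) / (4 * s\<^sup>2)"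
        by (simp add: power_divide add_divide_distrib power_mult_distrib)
      also have "\<dots> = (1 - (n $ 3)\<^sup>2) / (2 * (1 + n $ 3))"
      proof -
        have "(n $ 1)\<^sup>2 + (n $ 2)\<^sup>2 = 1 - (n $ 3)\<^sup>2" "4 * s\<^sup>2 = 2 * (1 + n $ 3)"
          using sq s2 by simp_all
        then show ?thesis by simp
      qed
      also have "\<dots> = (1 - n $ 3) / 2"
        using False n3 by (simp add: field_simps power2_eq_square)
      finally show ?thesis .
    qed
    show thesis
    proof (rule that[of b])
      have "(cmod (b $ 1))\<^sup>2 + (cmod (b $ 2))\<^sup>2 =
          s\<^sup>2 + ((n $ 1 / (2 * s))\<^sup>2 + (n $ 2 / (2 * s))\<^sup>2)"
        by (simp add: b_def cmod_power2)
      also have "\<dots> = 1" unfolding e s2 by (simp add: field_simps)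
      finally show "norm b = 1" by (rule norm1)
      show "b $ 1 * cnj (b $ 1) = of_real ((1 + n $ 3) / 2)"
        using s2 by (simp add: b_def complex_eq_iff power2_eq_square)
      show "b $ 1 * cnj (b $ 2) = Complex (n $ 1 / 2) (- (n $ 2 / 2))"
        using s0 by (simp add: b_def complex_eq_iff)
      show "b $ 2 * cnj (b $ 1) = Complex (n $ 1 / 2) (n $ 2 / 2)"
        using s0 by (simp add: b_def complex_eq_iff)
      show "b $ 2 * cnj (b $ 2) = of_real ((1 - n $ 3) / 2)"
        using e by (simp add: b_def complex_eq_iff power2_eq_square)
    qed
  qed
qed

section \<open>Pauli expansion of two-qubit operators\<close>

definition pauli :: "3 \<Rightarrow> complex^2^2" where
  "pauli a = (if a = 1 then vector [vector [0, 1], vector [1, 0]]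
     else if a = 2 then vector [vector [0, - \<i>], vector [\<i>, 0]]
     else vector [vector [1, 0], vector [0, -1]])"

definition delta :: "'n \<Rightarrow> 'n \<Rightarrow> complex" where
  "delta i j = (if i = j then 1 else 0)"

text \<open>The coefficient of the identity is \<open>trace N\<close> instead of 1, which makes the map linear.\<close>

definition moment_op :: "(real^3^3) \<times> (real^3) \<Rightarrow> two_qubit_op" where
  "moment_op p = (\<chi> P Q. (1 / 4) *
     (of_real (trace (fst p)) * delta (fst P) (fst Q) * delta (snd P) (snd Q)
      + (\<Sum>a\<in>UNIV. of_real (snd p $ a) *
          (pauli a $ fst P $ fst Q * delta (snd P) (snd Q) + delta (fst P) (fst Q) * pauli a $ snd P $ snd Q))
      + (\<Sum>a\<in>UNIV. \<Sum>b\<in>UNIV. of_real (fst p $ a $ b) * (pauli a $ fst P $ fst Q * pauli b $ snd P $ snd Q))))"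

lemma linear_moment_op: "linear moment_op"
proof (rule linearI)
  show "moment_op (p + q) = moment_op p + moment_op q" for p q
    by (simp add: moment_op_def vec_eq_iff trace_def sum_3 algebra_simps add_divide_distrib)
  show "moment_op (c *\<^sub>R p) = c *\<^sub>R moment_op p" for c p
    unfolding moment_op_def
    by (simp add: vec_eq_iff trace_def sum_3 algebra_simps scaleR_conv_of_real[where 'a = complex])
qed

text \<open>Expanding P n \<otimes> P n in Pauli matrices gives the coefficients 1, n and n
  n^T.\<close>

lemma moment_op_outer:
  assumes n: "norm n = 1"
  obtains b :: "complex^2" where "norm b = 1" "moment_op (outer n, n) = projector (tensor b b)"
proof -
  obtain b :: "complex^2" where b: "norm b = 1"
    "b $ 1 * cnj (b $ 1) = of_real ((1 + n $ 3) / 2)"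
    "b $ 1 * cnj (b $ 2) = Complex (n $ 1 / 2) (- (n $ 2 / 2))"
    "b $ 2 * cnj (b $ 1) = Complex (n $ 1 / 2) (n $ 2 / 2)"
    "b $ 2 * cnj (b $ 2) = of_real ((1 - n $ 3) / 2)"
    using bloch_spinor[OF n] by blast
  have P: "b $ i * cnj (b $ j) = (delta i j + (\<Sum>a\<in>UNIV. of_real (n $ a) * pauli a $ i $ j)) / 2" for i j
    using exhaust_2[of i] exhaust_2[of j] b(2-)
    by (auto simp: sum_3 pauli_def delta_def complex_eq_iff)
  have "trace (outer n) = 1" using n by (simp add: trace_outer norm_eq_1)
  then have "moment_op (outer n, n) $ (i, j) $ (k, l) = (b $ i * cnj (b $ k)) * (b $ j * cnj (b $ l))" for i j k l
    unfolding P by (simp add: moment_op_def sum_3 outer_def algebra_simps)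
  then have "moment_op (outer n, n) = projector (tensor b b)"
    by (simp add: vec_eq_iff split_paired_all projector_def tensor_def mult_ac)
  then show thesis using b(1) that by blast
qed

text \<open>A linear map carries the hull of the point-mass moments onto the hull of their images,
  which are product projectors.\<close>

lemma separable_moment_op:
  assumes "p \<in> sphere_moments"
  shows "separable (moment_op p)"
proof -
  have "moment_op p \<in> moment_op ` (convex hull {(outer n, n) |n. norm n = 1})"
    using assms sphere_moments_subset_hull by blast
  also have "\<dots> = convex hull (moment_op ` {(outer n, n) |n. norm n = 1})"
    by (simp add: convex_hull_linear_image linear_moment_op)
  also have "\<dots> \<subseteq> convex hull {projector (tensor a b) | a b. norm a = 1 \<and> norm b = 1}"
    by (rule hull_mono) (use moment_op_outer in \<open>auto, metis\<close>)
  finally show ?thesis by (simp add: separable_def)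
qed

section \<open>Diagonalization in \<open>SU(3)\<close>\<close>

lemma mult_vec_axis:
  fixes A :: "'a::semiring_1^'n^'m"
  shows "A *v axis k 1 = (\<chi> i. A $ i $ k)"
  by (simp add: matrix_vector_mult_def axis_def if_distrib cong: if_cong)

lemma cadjoint_mult: "cadjoint (A ** B) = cadjoint B ** cadjoint A"
  by (simp add: cadjoint_def matrix_matrix_mult_def vec_eq_iff mult.commute)

lemma cadjoint_cadjoint [simp]: "cadjoint (cadjoint A) = A"
  by (simp add: cadjoint_def vec_eq_iff)

lemma det_cadjoint: "det (cadjoint A) = cnj (det A)"
proof -
  have "cnj (det A) = det (transpose (cadjoint A))"
    by (simp add: det_def transpose_def cadjoint_def)
  then show ?thesis by (simp add: det_transpose)
qed

lemma cinner_cadjoint: "cinner v (A *v w) = cinner (cadjoint A *v v) w"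
  unfolding cinner_def matrix_vector_mult_def cadjoint_def
  by (simp add: sum_distrib_left sum_distrib_right mult_ac) (rule sum.swap)

lemma cinner_self: "cinner v v = of_real ((norm v)\<^sup>2)"
  by (simp add: cinner_def norm_vec_def L2_set_def sum_nonneg complex_norm_square mult.commute
      del: of_real_power)

lemma special_unitary_mult: "U \<in> special_unitary \<Longrightarrow> V \<in> special_unitary \<Longrightarrow> U ** V \<in> special_unitary"
  unfolding special_unitary_def
  by (simp add: cadjoint_mult det_mul) (metis matrix_mul_assoc matrix_mul_rid)

lemma special_unitary_cadjoint: "U \<in> special_unitary \<Longrightarrow> cadjoint U \<in> special_unitary"
  unfolding special_unitary_def
  by (simp add: det_cadjoint matrix_left_right_inverse)

lemma special_unitary_norm:
  assumes "U \<in> special_unitary"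
  shows "norm (U *v v) = norm v"
proof -
  have "cinner (U *v v) (U *v v) = cinner v v"
    using assms by (simp add: cinner_cadjoint matrix_vector_mul_assoc special_unitary_def)
  then have "(norm (U *v v))\<^sup>2 = (norm v)\<^sup>2" unfolding cinner_self by (simp only: of_real_eq_iff)
  then show ?thesis by simp
qed

lemma hermitian_entries:
  assumes "cadjoint A = A"
  shows "A $ j $ i = cnj (A $ i $ j)"
  using assms by (metis (no_types) cadjoint_def vec_lambda_beta)

lemma hermitian_diag:
  assumes "cadjoint A = A"
  shows "Im (A $ i $ i) = 0"
  using arg_cong[OF hermitian_entries[OF assms, of i i], of Im] by simp

lemma poly_charpoly: "poly (charpoly A) x = det (mat x - A)"
proof -
  have "poly (charpoly A) x = det (\<chi> i j. poly (((if i = j then [:0, 1:] else 0) - [:A $ i $ j:])) x)"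
    by (simp add: charpoly_def det_def poly_sum poly_prod)
  also have "(\<chi> i j. poly (((if i = j then [:0, 1:] else 0) - [:A $ i $ j:])) x) = mat x - A"
    by (simp add: vec_eq_iff mat_def)
  finally show ?thesis .
qed

text \<open>Scalar matrices commute with \<open>U\<close>, so \<open>mat x\<close> minus the
  conjugate of \<open>A\<close> is the conjugate of \<open>mat x - A\<close>. Polynomials with equal
  values everywhere coincide.\<close>

lemma charpoly_unitary_conjugate:
  assumes "U \<in> special_unitary"
  shows "charpoly (U ** A ** cadjoint U) = charpoly A"
proof -
  have U: "U ** cadjoint U = mat 1" "det U = 1" "det (cadjoint U) = 1"
    using assms special_unitary_cadjoint[OF assms] by (simp_all add: special_unitary_def)
  have "det (mat x - U ** A ** cadjoint U) = det (mat x - A)" for x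
  proof -
    have "U ** mat x ** cadjoint U = mat x"
    proof -
      have "U ** mat x = mat x ** U"
        by (simp add: vec_eq_iff matrix_matrix_mult_def mat_def if_distrib if_distribR cong: if_cong)
      then show ?thesis by (metis U(1) matrix_mul_assoc matrix_mul_rid)
    qed
    moreover have "U ** (mat x - A) = U ** mat x - U ** A"
      by (simp add: matrix_matrix_mult_def vec_eq_iff right_diff_distrib sum_subtractf)
    moreover have "(U ** mat x - U ** A) ** cadjoint U = U ** mat x ** cadjoint U - U ** A ** cadjoint U"
      by (simp add: matrix_matrix_mult_def vec_eq_iff left_diff_distrib sum_subtractf)
    ultimately have "mat x - U ** A ** cadjoint U = U ** (mat x - A) ** cadjoint U"
      by simp
    then show ?thesis by (simp add: det_mul U)
  qed
  then show ?thesis by (simp add: poly_eq_poly_eq_iff[symmetric] fun_eq_iff poly_charpoly)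
qed

definition diag3 :: "real \<Rightarrow> real \<Rightarrow> real \<Rightarrow> complex^3^3" where
  "diag3 a b c = (\<chi> i j. if i = j then of_real (if i = 1 then a else if i = 2 then b else c) else 0)"

lemma eigenvalues_diag3: "eigenvalues (diag3 a b c) = {#of_real a, of_real b, of_real c#}"
proof -
  have "charpoly (diag3 a b c) = [:- of_real a, 1:] * [:- of_real b, 1:] * [:- of_real c, 1:]"
    by (simp add: poly_eq_poly_eq_iff[symmetric] fun_eq_iff poly_charpoly det_3 mat_def diag3_def algebra_simps)
  then show ?thesis by (simp add: eigenvalues_def proots_mult del: mult_pCons_left mult_pCons_right)
qed

lemma eigenvector_of_eigenvalue:
  fixes A :: "complex^'n^'n"
  assumes "l \<in># eigenvalues A"
  obtains v where "norm v = 1" "A *v v = l *s v"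
proof -
  have "poly (charpoly A) l = 0"
    using assms unfolding eigenvalues_def by (cases "charpoly A = 0") auto
  then have "det (mat l - A) = 0" by (simp add: poly_charpoly)
  then obtain w where w: "w \<noteq> 0" "(mat l - A) *v w = 0"
    using matrix_left_invertible_ker[of "mat l - A"] by (metis invertible_det_nz invertible_left_inverse)
  have "mat l *v w = l *s w"
    by (simp add: vec_eq_iff matrix_vector_mult_def mat_def if_distrib if_distribR cong: if_cong)
  then have Aw: "A *v w = l *s w" using w(2) by (simp add: matrix_vector_mult_diff_rdistrib)
  define v where "v = of_real (1 / norm w) *s w"
  have "norm v = 1"
  proof -
    have "v = (1 / norm w) *\<^sub>R w" by (simp add: v_def vec_eq_iff scaleR_conv_of_real[where 'a = complex])
    then show ?thesis using w by simp
  qed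
  moreover have "A *v v = l *s v"
    by (simp add: v_def vector_scalar_commute Aw vector_smult_assoc mult.commute)
  ultimately show thesis using that by blast
qed

section \<open>Unitaries built from eigenvectors\<close>

lemma orthogonal_unit_vector:
  fixes v :: "complex^3"
  obtains w where "norm w = 1" "cinner v w = 0"
proof -
  obtain w where w: "w \<noteq> 0" "cinner v w = 0"
  proof (cases "v $ 1 = 0 \<and> v $ 2 = 0")
    case True
    then show thesis
      by (intro that[of "axis 1 1"]) (simp_all add: cinner_def sum_3 axis_def vec_eq_iff exI[of _ 1])
  next
    case False
    then show thesis
      by (intro that[of "vector [- cnj (v $ 2), cnj (v $ 1), 0]"])
        (auto simp add: cinner_def sum_3 vec_eq_iff forall_3)
  qed
  have "cinner v ((1 / norm w) *\<^sub>R w) = 0"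
    using w(2) by (simp add: cinner_def sum_3 scaleR_conv_of_real[where 'a = complex] flip: add_divide_distrib)
  then show thesis using w(1) by (intro that[of "(1 / norm w) *\<^sub>R w"]) simp_all
qed

text \<open>The third column is the conjugated cross product of the first two; it is orthogonal to
  both, and the determinant becomes its squared norm, which is 1.\<close>

lemma special_unitary_extending:
  fixes v :: "complex^3"
  assumes v: "norm v = 1"
  obtains E where "E \<in> special_unitary" "E *v axis 1 1 = v"
proof -
  obtain w where w: "norm w = 1" "cinner v w = 0" by (rule orthogonal_unit_vector)
  define x :: "complex^3" where "x = vector [cnj (v $ 2 * w $ 3 - v $ 3 * w $ 2),
     cnj (v $ 3 * w $ 1 - v $ 1 * w $ 3), cnj (v $ 1 * w $ 2 - v $ 2 * w $ 1)]"
  define E :: "complex^3^3" where "E = (\<chi> i j. if j = 1 then v $ i else if j = 2 then w $ i else x $ i)"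
  have vv: "cnj (v $ 1) * v $ 1 + cnj (v $ 2) * v $ 2 + cnj (v $ 3) * v $ 3 = 1"
    using cinner_self[of v] v by (simp add: cinner_def sum_3)
  have ww: "cnj (w $ 1) * w $ 1 + cnj (w $ 2) * w $ 2 + cnj (w $ 3) * w $ 3 = 1"
    using cinner_self[of w] w by (simp add: cinner_def sum_3)
  have vw: "cnj (v $ 1) * w $ 1 + cnj (v $ 2) * w $ 2 + cnj (v $ 3) * w $ 3 = 0"
    using w by (simp add: cinner_def sum_3)
  have wv: "v $ 1 * cnj (w $ 1) + v $ 2 * cnj (w $ 2) + v $ 3 * cnj (w $ 3) = 0"
    using arg_cong[OF vw, of cnj] by simp
  \<comment> \<open>Lagrange's identity for the norm of a cross product.\<close>
  have xx: "cnj (x $ 1) * x $ 1 + cnj (x $ 2) * x $ 2 + cnj (x $ 3) * x $ 3 =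
     (cnj (v $ 1) * v $ 1 + cnj (v $ 2) * v $ 2 + cnj (v $ 3) * v $ 3) *
     (cnj (w $ 1) * w $ 1 + cnj (w $ 2) * w $ 2 + cnj (w $ 3) * w $ 3) -
     (cnj (v $ 1) * w $ 1 + cnj (v $ 2) * w $ 2 + cnj (v $ 3) * w $ 3) *
     (v $ 1 * cnj (w $ 1) + v $ 2 * cnj (w $ 2) + v $ 3 * cnj (w $ 3))"
    by (simp add: x_def algebra_simps)
  then have xx: "cnj (x $ 1) * x $ 1 + cnj (x $ 2) * x $ 2 + cnj (x $ 3) * x $ 3 = 1"
    unfolding vv ww vw by simp
  have "cadjoint E ** E = mat 1"
    using vv ww vw wv xx
    by (simp add: vec_eq_iff forall_3 matrix_matrix_mult_def cadjoint_def sum_3 E_def mat_def mult.commute)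
       (simp add: x_def algebra_simps)
  moreover have "det E = 1"
  proof -
    have "det E = cnj (x $ 1) * x $ 1 + cnj (x $ 2) * x $ 2 + cnj (x $ 3) * x $ 3"
      by (simp add: det_3 E_def) (simp add: x_def algebra_simps)
    then show ?thesis using xx by simp
  qed
  moreover have "E *v axis 1 1 = v"
    by (simp add: mult_vec_axis E_def vec_eq_iff)
  ultimately show thesis using that[of E] by (simp add: special_unitary_def)
qed

text \<open>The Hermitian matrix with rows \<open>(p, z)\<close> and \<open>(cnj z, q)\<close> is \<open>k + 2 s b b\<^sup>*\<close>.\<close>

lemma hermitian_2_decomposition:
  fixes p q :: real and z :: complex
  obtains k s :: real and b :: "complex^2" where "norm b = 1"
    "of_real p = of_real k + 2 * of_real s * (b $ 1 * cnj (b $ 1))"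
    "z = 2 * of_real s * (b $ 1 * cnj (b $ 2))"
    "of_real q = of_real k + 2 * of_real s * (b $ 2 * cnj (b $ 2))"
proof -
  \<comment> \<open>\<open>u\<close> holds the Pauli coefficients of the traceless part. Its length
    is half the eigenvalue gap; if it is 0, any direction \<open>n\<close> serves.\<close>
  define u :: "real^3" where "u = vector [Re z, - Im z, (p - q) / 2]"
  define n :: "real^3" where "n = (if u = 0 then axis 1 1 else (1 / norm u) *\<^sub>R u)"
  have n: "norm n = 1" by (simp add: n_def)
  have u: "u $ i = norm u * n $ i" for i by (simp add: n_def)
  obtain b :: "complex^2" where b: "norm b = 1"
    "b $ 1 * cnj (b $ 1) = of_real ((1 + n $ 3) / 2)"
    "b $ 1 * cnj (b $ 2) = Complex (n $ 1 / 2) (- (n $ 2 / 2))"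
    "b $ 2 * cnj (b $ 1) = Complex (n $ 1 / 2) (n $ 2 / 2)"
    "b $ 2 * cnj (b $ 2) = of_real ((1 - n $ 3) / 2)"
    using bloch_spinor[OF n] by blast
  have "Re z = norm u * n $ 1" "- Im z = norm u * n $ 2" "(p - q) / 2 = norm u * n $ 3"
    using u[of 1] u[of 2] u[of 3] by (simp_all add: u_def)
  then show thesis
    by (intro that[of b "(p + q) / 2 - norm u" "norm u"])
      (simp_all add: b complex_eq_iff field_simps)
qed

text \<open>Rotating an eigenvector for \<open>a\<close> to the first axis splits off a Hermitian 2
  by 2 block, which a spinor diagonalizes.\<close>

lemma hermitian_3_diagonalizable:
  fixes A :: "complex^3^3"
  assumes herm: "cadjoint A = A" and a: "of_real a \<in># eigenvalues A"
  obtains U b c where "U \<in> special_unitary" "U ** A ** cadjoint U = diag3 a b c"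
proof -
  obtain v where v: "norm v = 1" "A *v v = of_real a *s v"
    using eigenvector_of_eigenvalue[OF a] .
  obtain E where E: "E \<in> special_unitary" "E *v axis 1 1 = v"
    using special_unitary_extending[OF v(1)] .
  define B where "B = cadjoint E ** A ** E"
  have hermB: "cadjoint B = B"
    by (simp add: B_def cadjoint_mult herm matrix_mul_assoc)
  note B = hermitian_entries[OF hermB]
  have real: "B $ i $ i = of_real (Re (B $ i $ i))" for i
    using hermitian_diag[OF hermB] by (simp add: complex_eq_iff)
  have "B *v axis 1 1 = of_real a *s (cadjoint E *v (E *v axis 1 1))"
    unfolding B_def
    by (metis E(2) matrix_vector_mul_assoc v(2) vector_scalar_commute)
  also have "\<dots> = of_real a *s axis 1 1"
    using E(1) by (simp add: special_unitary_def matrix_vector_mul_assoc)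
  finally have "(\<chi> i. B $ i $ 1) = of_real a *s axis 1 1" by (simp only: mult_vec_axis)
  then have B1: "B $ i $ 1 = (if i = 1 then of_real a else 0)" for i
    by (simp add: vec_eq_iff axis_def)
  have B1': "B $ 1 $ i = (if i = 1 then of_real a else 0)" for i
    unfolding B[of 1 i] B1[of i] by simp
  obtain k s :: real and b :: "complex^2" where b: "norm b = 1"
    "B $ 2 $ 2 = of_real k + 2 * of_real s * (b $ 1 * cnj (b $ 1))"
    "B $ 2 $ 3 = 2 * of_real s * (b $ 1 * cnj (b $ 2))"
    "B $ 3 $ 3 = of_real k + 2 * of_real s * (b $ 2 * cnj (b $ 2))"
    using hermitian_2_decomposition[of "Re (B $ 2 $ 2)" "B $ 2 $ 3" "Re (B $ 3 $ 3)"] real by metis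
  have b32: "B $ 3 $ 2 = 2 * of_real s * (b $ 2 * cnj (b $ 1))"
    unfolding B[of 3 2] b(3) by (simp add: mult.commute)
  have nb: "b $ 1 * cnj (b $ 1) + b $ 2 * cnj (b $ 2) = 1"
    using cinner_self[of b] b(1) by (simp add: cinner_def sum_2 mult.commute)
  \<comment> \<open>The last two columns are \<open>b\<close> and its orthogonal spinor, both
    eigenvectors of the block.\<close>
  define F :: "complex^3^3" where
    "F = vector [vector [1, 0, 0], vector [0, b $ 1, - cnj (b $ 2)], vector [0, b $ 2, cnj (b $ 1)]]"
  have F: "F \<in> special_unitary"
    using nb by (simp add: special_unitary_def vec_eq_iff forall_3 matrix_matrix_mult_def cadjoint_def
        sum_3 F_def mat_def det_3 mult.commute add.commute)
  define D where "D = cadjoint F ** B ** F"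
  have hermD: "cadjoint D = D"
    by (simp add: D_def cadjoint_mult hermB matrix_mul_assoc)
  note Dc = hermitian_entries[OF hermD]
  have Dreal: "D $ i $ i = of_real (Re (D $ i $ i))" for i
    using hermitian_diag[OF hermD] by (simp add: complex_eq_iff)
  have D1: "D $ 1 $ 1 = of_real a" "D $ 1 $ 2 = 0" "D $ 1 $ 3 = 0"
    by (simp_all add: D_def matrix_matrix_mult_def cadjoint_def sum_3 F_def B1 B1')
  have D23: "D $ 2 $ 3 = 0"
    by (simp add: D_def matrix_matrix_mult_def cadjoint_def sum_3 F_def B1 B1' b b32 algebra_simps)
  have D: "D = diag3 a (Re (D $ 2 $ 2)) (Re (D $ 3 $ 3))"
    using D1 D23 Dc[of 2 1] Dc[of 3 1] Dc[of 3 2] Dreal[of 2] Dreal[of 3]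
    by (simp add: vec_eq_iff forall_3 diag3_def)
  have "cadjoint (E ** F) ** A ** cadjoint (cadjoint (E ** F)) = D"
    by (simp add: D_def B_def cadjoint_mult matrix_mul_assoc)
  then show thesis
    using that[of "cadjoint (E ** F)"] special_unitary_cadjoint special_unitary_mult E(1) F D by metis
qed

text \<open>Any prescribed order of the eigenvalues is attained: the multiset determines the last
  two up to exchange, and a rotation exchanges them.\<close>

lemma special_unitary_diagonalization:
  fixes A :: "complex^3^3"
  assumes herm: "cadjoint A = A" and eig: "eigenvalues A = {#of_real a, of_real b, of_real c#}"
  obtains U where "U \<in> special_unitary" "U ** A ** cadjoint U = diag3 a b c"
proof -
  obtain U b' c' where U: "U \<in> special_unitary" "U ** A ** cadjoint U = diag3 a b' c'"
    using hermitian_3_diagonalizable[OF herm, of a] eig by auto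
  have "eigenvalues (diag3 a b' c') = eigenvalues A"
    using charpoly_unitary_conjugate[OF U(1), of A] by (simp add: U eigenvalues_def)
  then have "{#complex_of_real b', of_real c'#} = {#of_real b, of_real c#}"
    by (simp add: eig eigenvalues_diag3)
  then consider "b' = b" "c' = c" | "b' = c" "c' = b"
    by (auto simp: add_eq_conv_ex)
  then show thesis
  proof cases
    case 1
    then show thesis using that U by simp
  next
    case 2
    \<comment> \<open>The minus sign gives the exchange determinant 1.\<close>
    define R :: "complex^3^3" where "R = vector [vector [1, 0, 0], vector [0, 0, -1], vector [0, 1, 0]]"
    have R: "R \<in> special_unitary"
      by (simp add: special_unitary_def vec_eq_iff forall_3 matrix_matrix_mult_def cadjoint_def
        sum_3 R_def mat_def det_3)
    have "R ** diag3 a c b ** cadjoint R = diag3 a b c"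
      by (simp add: vec_eq_iff forall_3 matrix_matrix_mult_def cadjoint_def sum_3 R_def diag3_def)
    then have "(R ** U) ** A ** cadjoint (R ** U) = diag3 a b c"
      by (metis U(2) 2 cadjoint_mult matrix_mul_assoc)
    then show thesis using that special_unitary_mult[OF R U(1)] by blast
  qed
qed

section \<open>Separability of symmetric states\<close>

text \<open>The Pauli coefficients of \<open>sym_lift \<sigma>\<close>, written in the entries of \<open>\<sigma>\<close>.\<close>

definition moments_of :: "complex^3^3 \<Rightarrow> (real^3^3) \<times> (real^3)" where
  "moments_of \<sigma> =
    (vector [
      vector [Re (\<sigma> $ 2 $ 2) + 2 * Re (\<sigma> $ 1 $ 3), - 2 * Im (\<sigma> $ 1 $ 3), sqrt 2 * Re (\<sigma> $ 1 $ 2 - \<sigma> $ 2 $ 3)],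
      vector [- 2 * Im (\<sigma> $ 1 $ 3), Re (\<sigma> $ 2 $ 2) - 2 * Re (\<sigma> $ 1 $ 3), - sqrt 2 * Im (\<sigma> $ 1 $ 2 - \<sigma> $ 2 $ 3)],
      vector [sqrt 2 * Re (\<sigma> $ 1 $ 2 - \<sigma> $ 2 $ 3), - sqrt 2 * Im (\<sigma> $ 1 $ 2 - \<sigma> $ 2 $ 3),
        Re (\<sigma> $ 1 $ 1) + Re (\<sigma> $ 3 $ 3) - Re (\<sigma> $ 2 $ 2)]],
     vector [sqrt 2 * Re (\<sigma> $ 1 $ 2 + \<sigma> $ 2 $ 3), - sqrt 2 * Im (\<sigma> $ 1 $ 2 + \<sigma> $ 2 $ 3),
       Re (\<sigma> $ 1 $ 1) - Re (\<sigma> $ 3 $ 3)])"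

lemma sym_iso_entries:
  "sym_iso $ (1, 1) $ 1 = 1" "sym_iso $ (1, 1) $ 2 = 0" "sym_iso $ (1, 1) $ 3 = 0"
  "sym_iso $ (1, 2) $ 1 = 0" "sym_iso $ (1, 2) $ 2 = of_real (sqrt 2 / 2)" "sym_iso $ (1, 2) $ 3 = 0"
  "sym_iso $ (2, 1) $ 1 = 0" "sym_iso $ (2, 1) $ 2 = of_real (sqrt 2 / 2)" "sym_iso $ (2, 1) $ 3 = 0"
  "sym_iso $ (2, 2) $ 1 = 0" "sym_iso $ (2, 2) $ 2 = 0" "sym_iso $ (2, 2) $ 3 = 1"
  by (simp_all add: sym_iso_def dicke_def tensor_def axis_def scaleR_conv_of_real[where 'a = complex]
      real_div_sqrt field_simps flip: of_real_mult)

lemma sym_lift_entry: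
  "sym_lift U $ P $ Q =
    (\<Sum>j\<in>UNIV. (\<Sum>k\<in>UNIV. sym_iso $ P $ k * U $ k $ j) * cnj (sym_iso $ Q $ j))"
  by (simp add: sym_lift_def matrix_matrix_mult_def cadjoint_def)

lemma sym_lift_eq_moment_op:
  assumes herm: "cadjoint \<sigma> = \<sigma>"
  shows "sym_lift \<sigma> = moment_op (moments_of \<sigma>)"
proof -
  have [simp]: "\<sigma> $ 2 $ 1 = cnj (\<sigma> $ 1 $ 2)" "\<sigma> $ 3 $ 1 = cnj (\<sigma> $ 1 $ 3)" "\<sigma> $ 3 $ 2 = cnj (\<sigma> $ 2 $ 3)"
    by (rule hermitian_entries[OF herm])+
  have [simp]: "Im (\<sigma> $ 1 $ 1) = 0" "Im (\<sigma> $ 2 $ 2) = 0" "Im (\<sigma> $ 3 $ 3) = 0"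
    using herm by (simp_all only: hermitian_diag)
  have r2: "sqrt 2 * (sqrt 2 * t) = 2 * t" for t by simp
  have pauli: "pauli 1 $ 1 $ 1 = 0" "pauli 1 $ 1 $ 2 = 1" "pauli 1 $ 2 $ 1 = 1" "pauli 1 $ 2 $ 2 = 0"
    "pauli 2 $ 1 $ 1 = 0" "pauli 2 $ 1 $ 2 = - \<i>" "pauli 2 $ 2 $ 1 = \<i>" "pauli 2 $ 2 $ 2 = 0"
    "pauli 3 $ 1 $ 1 = 1" "pauli 3 $ 1 $ 2 = 0" "pauli 3 $ 2 $ 1 = 0" "pauli 3 $ 2 $ 2 = -1"
    by (simp_all add: pauli_def)
  have delta: "delta (1::2) 1 = 1" "delta (1::2) 2 = 0" "delta (2::2) 1 = 0" "delta (2::2) 2 = 1"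
    by (simp_all add: delta_def)
  have "sym_lift \<sigma> $ (i, j) $ (k, l) = moment_op (moments_of \<sigma>) $ (i, j) $ (k, l)" for i j k l
    using exhaust_2[of i] exhaust_2[of j] exhaust_2[of k] exhaust_2[of l]
    by (elim disjE; hypsubst)
      (simp_all add: sym_lift_entry sum_3 sym_iso_entries pauli delta moment_op_def moments_of_def trace_def complex_eq_iff field_simps r2
        del: of_real_divide)
  then show ?thesis by (simp add: vec_eq_iff split_paired_all)
qed

section \<open>Expectations in the spin-1 basis adapted to a direction\<close>

lemma cinner_hermitian_3:
  fixes \<sigma> :: "complex^3^3"
  assumes "cadjoint \<sigma> = \<sigma>"
  shows "Re (cinner f (\<sigma> *v f)) =
     Re (\<sigma> $ 1 $ 1) * Re (cnj (f $ 1) * f $ 1) + Re (\<sigma> $ 2 $ 2) * Re (cnj (f $ 2) * f $ 2)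
     + Re (\<sigma> $ 3 $ 3) * Re (cnj (f $ 3) * f $ 3)
     + 2 * Re (\<sigma> $ 1 $ 2 * (cnj (f $ 1) * f $ 2)) + 2 * Re (\<sigma> $ 1 $ 3 * (cnj (f $ 1) * f $ 3))
     + 2 * Re (\<sigma> $ 2 $ 3 * (cnj (f $ 2) * f $ 3))"
proof -
  have [simp]: "\<sigma> $ 2 $ 1 = cnj (\<sigma> $ 1 $ 2)" "\<sigma> $ 3 $ 1 = cnj (\<sigma> $ 1 $ 3)" "\<sigma> $ 3 $ 2 = cnj (\<sigma> $ 2 $ 3)"
    by (rule hermitian_entries[OF assms])+
  have [simp]: "Im (\<sigma> $ 1 $ 1) = 0" "Im (\<sigma> $ 2 $ 2) = 0" "Im (\<sigma> $ 3 $ 3) = 0"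
    using assms by (simp_all only: hermitian_diag)
  show ?thesis
    by (simp add: cinner_def matrix_vector_mult_def sum_3 algebra_simps)
qed

text \<open>\<open>f\<close> has the Dicke coordinates of the product state
  \<open>tensor b b\<close>, whose projector is P n \<otimes> P n.\<close>

lemma coherent_expectation:
  fixes n :: "real^3"
  assumes herm: "cadjoint \<sigma> = \<sigma>" and tr: "trace \<sigma> = 1" and n: "norm n = 1"
    and m: "moments_of \<sigma> = (N, r)"
  obtains f where "norm f = 1" "Re (cinner f (\<sigma> *v f)) = (1 + 2 * (r \<bullet> n) + n \<bullet> (N *v n)) / 4"
proof -
  obtain b :: "complex^2" where b: "norm b = 1"
    "b $ 1 * cnj (b $ 1) = of_real ((1 + n $ 3) / 2)"
    "b $ 1 * cnj (b $ 2) = Complex (n $ 1 / 2) (- (n $ 2 / 2))"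
    "b $ 2 * cnj (b $ 1) = Complex (n $ 1 / 2) (n $ 2 / 2)"
    "b $ 2 * cnj (b $ 2) = of_real ((1 - n $ 3) / 2)"
    using bloch_spinor[OF n] by blast
  have sq: "n $ 1 * n $ 1 = 1 - n $ 2 * n $ 2 - n $ 3 * n $ 3"
    using n by (simp add: norm_eq_1 inner_vec_def sum_3)
  have sq': "n $ 1 * (n $ 1 * t) = t - n $ 2 * (n $ 2 * t) - n $ 3 * (n $ 3 * t)" for t
    unfolding mult.assoc[symmetric] sq by (simp add: algebra_simps)
  have tr': "Re (\<sigma> $ 1 $ 1) + Re (\<sigma> $ 2 $ 2) + Re (\<sigma> $ 3 $ 3) = 1"
    using arg_cong[OF tr, of Re] by (simp add: trace_def sum_3)
  define f :: "complex^3" where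
    "f = vector [b $ 1 * b $ 1, of_real (sqrt 2) * (b $ 1 * b $ 2), b $ 2 * b $ 2]"
  have [simp]: "complex_of_real (sqrt 2) * complex_of_real (sqrt 2) = 2"
    by (simp flip: of_real_mult)
  have "cnj (f $ 1) * f $ 1 = (b $ 1 * cnj (b $ 1)) * (b $ 1 * cnj (b $ 1))"
    "cnj (f $ 2) * f $ 2 = (of_real (sqrt 2) * of_real (sqrt 2)) * ((b $ 1 * cnj (b $ 1)) * (b $ 2 * cnj (b $ 2)))"
    "cnj (f $ 3) * f $ 3 = (b $ 2 * cnj (b $ 2)) * (b $ 2 * cnj (b $ 2))"
    "cnj (f $ 1) * f $ 2 = of_real (sqrt 2) * ((b $ 1 * cnj (b $ 1)) * (b $ 2 * cnj (b $ 1)))"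
    "cnj (f $ 1) * f $ 3 = (b $ 2 * cnj (b $ 1)) * (b $ 2 * cnj (b $ 1))"
    "cnj (f $ 2) * f $ 3 = of_real (sqrt 2) * ((b $ 2 * cnj (b $ 1)) * (b $ 2 * cnj (b $ 2)))"
    by (simp_all add: f_def mult_ac)
  then have f: "cnj (f $ 1) * f $ 1 = of_real (((1 + n $ 3) / 2) * ((1 + n $ 3) / 2))"
    "cnj (f $ 2) * f $ 2 = of_real (2 * (((1 + n $ 3) / 2) * ((1 - n $ 3) / 2)))"
    "cnj (f $ 3) * f $ 3 = of_real (((1 - n $ 3) / 2) * ((1 - n $ 3) / 2))"
    "cnj (f $ 1) * f $ 2 = of_real (sqrt 2) * (of_real ((1 + n $ 3) / 2) * Complex (n $ 1 / 2) (n $ 2 / 2))"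
    "cnj (f $ 1) * f $ 3 = Complex (n $ 1 / 2) (n $ 2 / 2) * Complex (n $ 1 / 2) (n $ 2 / 2)"
    "cnj (f $ 2) * f $ 3 = of_real (sqrt 2) * (Complex (n $ 1 / 2) (n $ 2 / 2) * of_real ((1 - n $ 3) / 2))"
    unfolding b by simp_all
  have "of_real ((norm f)\<^sup>2) = cnj (f $ 1) * f $ 1 + cnj (f $ 2) * f $ 2 + cnj (f $ 3) * f $ 3"
    by (simp only: cinner_self[symmetric]) (simp add: cinner_def sum_3)
  also have "\<dots> = of_real 1"
    unfolding f of_real_add[symmetric] by (simp only: of_real_eq_iff) (simp add: field_simps)
  finally have "(norm f)\<^sup>2 = 1" by (simp only: of_real_eq_iff)
  then have "norm f = 1" using norm_ge_zero[of f] by (simp add: power2_eq_1_iff)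
  moreover have "Re (cinner f (\<sigma> *v f)) =
      (Re (\<sigma> $ 1 $ 1) + Re (\<sigma> $ 2 $ 2) + Re (\<sigma> $ 3 $ 3) + 2 * (r \<bullet> n) + n \<bullet> (N *v n)) / 4"
    using m[symmetric] unfolding cinner_hermitian_3[OF herm] f
    by (simp add: moments_of_def inner_vec_def matrix_vector_mult_def sum_3 field_simps sq sq')
  ultimately show thesis using that[of f] by (simp add: tr')
qed

text \<open>\<open>f\<close> is the normalized symmetrization of the product of \<open>b\<close>
  with its orthogonal spinor, the middle Dicke vector in direction \<open>n\<close>.\<close>

lemma equatorial_expectation:
  fixes n :: "real^3"
  assumes herm: "cadjoint \<sigma> = \<sigma>" and tr: "trace \<sigma> = 1" and n: "norm n = 1"
    and m: "moments_of \<sigma> = (N, r)"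
  obtains f where "norm f = 1" "Re (cinner f (\<sigma> *v f)) = (1 - n \<bullet> (N *v n)) / 2"
proof -
  obtain b :: "complex^2" where b: "norm b = 1"
    "b $ 1 * cnj (b $ 1) = of_real ((1 + n $ 3) / 2)"
    "b $ 1 * cnj (b $ 2) = Complex (n $ 1 / 2) (- (n $ 2 / 2))"
    "b $ 2 * cnj (b $ 1) = Complex (n $ 1 / 2) (n $ 2 / 2)"
    "b $ 2 * cnj (b $ 2) = of_real ((1 - n $ 3) / 2)"
    using bloch_spinor[OF n] by blast
  have sq: "n $ 1 * n $ 1 = 1 - n $ 2 * n $ 2 - n $ 3 * n $ 3"
    using n by (simp add: norm_eq_1 inner_vec_def sum_3)
  have sq': "n $ 1 * (n $ 1 * t) = t - n $ 2 * (n $ 2 * t) - n $ 3 * (n $ 3 * t)" for t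
    unfolding mult.assoc[symmetric] sq by (simp add: algebra_simps)
  have tr': "Re (\<sigma> $ 1 $ 1) + Re (\<sigma> $ 2 $ 2) + Re (\<sigma> $ 3 $ 3) = 1"
    using arg_cong[OF tr, of Re] by (simp add: trace_def sum_3)
  define f :: "complex^3" where
    "f = vector [- (of_real (sqrt 2) * (b $ 1 * cnj (b $ 2))), of_real (n $ 3),
      of_real (sqrt 2) * (b $ 2 * cnj (b $ 1))]"
  have f: "cnj (f $ 1) * f $ 1 = of_real ((n $ 1 * n $ 1 + n $ 2 * n $ 2) / 2)"
    "cnj (f $ 2) * f $ 2 = of_real (n $ 3 * n $ 3)"
    "cnj (f $ 3) * f $ 3 = of_real ((n $ 1 * n $ 1 + n $ 2 * n $ 2) / 2)"
    "cnj (f $ 1) * f $ 2 = - (of_real (sqrt 2 * n $ 3) * Complex (n $ 1 / 2) (n $ 2 / 2))"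
    "cnj (f $ 1) * f $ 3 = - (2 * (Complex (n $ 1 / 2) (n $ 2 / 2) * Complex (n $ 1 / 2) (n $ 2 / 2)))"
    "cnj (f $ 2) * f $ 3 = of_real (sqrt 2 * n $ 3) * Complex (n $ 1 / 2) (n $ 2 / 2)"
    unfolding f_def b by (simp_all add: complex_eq_iff field_simps)
  have "of_real ((norm f)\<^sup>2) = cnj (f $ 1) * f $ 1 + cnj (f $ 2) * f $ 2 + cnj (f $ 3) * f $ 3"
    by (simp only: cinner_self[symmetric]) (simp add: cinner_def sum_3)
  also have "\<dots> = of_real 1"
    unfolding f of_real_add[symmetric] by (simp only: of_real_eq_iff) (simp add: field_simps sq)
  finally have "(norm f)\<^sup>2 = 1" by (simp only: of_real_eq_iff)
  then have "norm f = 1" using norm_ge_zero[of f] by (simp add: power2_eq_1_iff)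
  moreover have "Re (cinner f (\<sigma> *v f)) =
      (Re (\<sigma> $ 1 $ 1) + Re (\<sigma> $ 2 $ 2) + Re (\<sigma> $ 3 $ 3) - n \<bullet> (N *v n)) / 2"
    using m[symmetric] unfolding cinner_hermitian_3[OF herm] f
    by (simp add: moments_of_def inner_vec_def matrix_vector_mult_def sum_3 field_simps sq sq')
  ultimately show thesis using that[of f] by (simp add: tr')
qed

text \<open>As \<open>y \<le> M\<close>, the sum of \<open>x\<close> and \<open>z\<close> is at
  least \<open>1 - M\<close>. With both at least \<open>m\<close>, their product is least when they
  are \<open>m\<close> and \<open>1 - M - m\<close>. In the application \<open>M\<close>,
  \<open>1 - M - m\<close>, \<open>m\<close> are the ordered eigenvalues.\<close>

lemma four_prod_ge_square:
  fixes m M x y z :: real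
  assumes "0 \<le> m" "m \<le> 1 - M - m" "M\<^sup>2 \<le> 4 * m * (1 - M - m)"
    and "m \<le> x" "m \<le> z" "m \<le> y" "y \<le> M" "x + y + z = 1"
  shows "y\<^sup>2 \<le> 4 * (x * z)"
proof -
  have prod: "m * (1 - M - m) \<le> u * v" if "m \<le> u" "u \<le> v" "1 - M \<le> u + v" for u v
  proof (cases "u \<le> 1 - M - m")
    case True
    have "0 \<le> (u - m) * (1 - M - m - u)" using that True by simp
    then have "m * (1 - M - m) \<le> u * (1 - M - u)" by (simp add: algebra_simps)
    also have "\<dots> \<le> u * v" using that assms by (intro mult_left_mono) auto
    finally show ?thesis .
  next
    case False
    then show ?thesis using that assms by (intro mult_mono) auto
  qed
  have "m * (1 - M - m) \<le> x * z"
    using prod[of x z] prod[of z x] assms by (cases "x \<le> z") (auto simp: mult.commute)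
  moreover have "y\<^sup>2 \<le> M\<^sup>2" using assms by (intro power_mono) auto
  ultimately show ?thesis using assms(3) by simp
qed

text \<open>The spectrum enters only through bounds on expectations, so the criterion applies
  equally to every unitary conjugate.\<close>

lemma separable_sym_lift:
  assumes herm: "cadjoint \<sigma> = \<sigma>" and tr: "trace \<sigma> = 1"
    and bounds: "\<And>f. norm f = 1 \<Longrightarrow> m \<le> Re (cinner f (\<sigma> *v f)) \<and> Re (cinner f (\<sigma> *v f)) \<le> M"
    and m: "0 \<le> m" "m \<le> 1 - M - m" "M\<^sup>2 \<le> 4 * m * (1 - M - m)"
  shows "separable (sym_lift \<sigma>)"
proof -
  obtain N r where Nr: "moments_of \<sigma> = (N, r)" by (cases "moments_of \<sigma>")
  have unit: "(r \<bullet> n)\<^sup>2 \<le> n \<bullet> (N *v n)" if n: "norm n = 1" for n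
  proof -
    define R X where "R = r \<bullet> n" and "X = n \<bullet> (N *v n)"
    \<comment> \<open>\<open>f1\<close> and \<open>f3\<close> are the coherent states at \<open>n\<close> and \<open>- n\<close>, \<open>f2\<close> completes them to a basis.\<close>
    obtain f1 where f1: "norm f1 = 1" "Re (cinner f1 (\<sigma> *v f1)) = (1 + 2 * R + X) / 4"
      using coherent_expectation[OF herm tr n Nr] unfolding R_def X_def by blast
    have "matrix_vector_mult N (- n) = - (N *v n)"
      using matrix_vector_mult_scaleR[of N "-1" n] by simp
    then obtain f3 where f3: "norm f3 = 1" "Re (cinner f3 (\<sigma> *v f3)) = (1 - 2 * R + X) / 4"
      using coherent_expectation[OF herm tr _ Nr, of "- n"] n unfolding R_def X_def by auto
    obtain f2 where f2: "norm f2 = 1" "Re (cinner f2 (\<sigma> *v f2)) = (1 - X) / 2"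
      using equatorial_expectation[OF herm tr n Nr] unfolding X_def by blast
    \<comment> \<open>The three expectations sum to 1; cleared of denominators, the inequality reads
      \<open>R\<^sup>2 \<le> X\<close>.\<close>
    have "((1 - X) / 2)\<^sup>2 \<le> 4 * ((1 + 2 * R + X) / 4 * ((1 - 2 * R + X) / 4))"
      using m bounds[OF f1(1)] bounds[OF f2(1)] bounds[OF f3(1)] unfolding f1 f2 f3
      by (intro four_prod_ge_square[where m = m and M = M]) (auto simp: field_simps)
    then show ?thesis by (simp add: power2_eq_square field_simps flip: R_def X_def)
  qed
  have "(r \<bullet> y)\<^sup>2 \<le> y \<bullet> (N *v y)" for y
  proof (cases "y = 0")
    case False
    define n where "n = (1 / norm y) *\<^sub>R y"
    have "y = norm y *\<^sub>R n" "norm n = 1" using False by (simp_all add: n_def)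
    have "(r \<bullet> y)\<^sup>2 = (norm y)\<^sup>2 * (r \<bullet> n)\<^sup>2"
      by (subst \<open>y = norm y *\<^sub>R n\<close>) (simp add: power_mult_distrib \<open>norm n = 1\<close>)
    also have "\<dots> \<le> (norm y)\<^sup>2 * (n \<bullet> (N *v n))"
      using unit[OF \<open>norm n = 1\<close>] by (intro mult_left_mono) auto
    also have "\<dots> = (norm y *\<^sub>R n) \<bullet> (N *v (norm y *\<^sub>R n))"
      by (simp add: matrix_vector_mult_scaleR power2_eq_square)
    finally show ?thesis using \<open>y = norm y *\<^sub>R n\<close> by simp
  qed simp
  moreover have "transpose N = N"
    using Nr[symmetric] by (simp add: moments_of_def transpose_def vec_eq_iff forall_3)
  moreover have "trace N = 1"
    using Nr[symmetric] arg_cong[OF tr, of Re] by (simp add: moments_of_def trace_def sum_3)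
  ultimately have "moments_of \<sigma> \<in> sphere_moments" by (simp add: Nr sphere_moments_def)
  then show ?thesis by (simp add: sym_lift_eq_moment_op[OF herm] separable_moment_op)
qed

section \<open>Absolute separability\<close>

lemma trace_mult_commute:
  fixes A :: "'a::comm_semiring_1^'n^'m" and B :: "'a^'m^'n"
  shows "trace (A ** B) = trace (B ** A)"
  unfolding trace_def matrix_matrix_mult_def
  by (simp add: mult.commute) (rule sum.swap)

text \<open>This moves the lifted unitaries to conjugation of a 3 by 3 matrix.\<close>

lemma sym_lift_conjugate:
  "sym_lift U ** \<rho> ** cadjoint (sym_lift U) = sym_lift (U ** sym_restrict \<rho> ** cadjoint U)"
  by (simp add: sym_lift_def sym_restrict_def cadjoint_mult matrix_mul_assoc)

lemma symmetric_state_sym_restrict: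
  assumes "symmetric_state \<rho>"
  shows "cadjoint (sym_restrict \<rho>) = sym_restrict \<rho>" "trace (sym_restrict \<rho>) = 1"
    "0 \<le> Re (cinner f (sym_restrict \<rho> *v f))"
proof -
  have psd: "cadjoint \<rho> = \<rho>" "0 \<le> Re (cinner v (\<rho> *v v))" and tr: "trace \<rho> = 1"
    and sym: "\<rho> *v v \<in> range ((*v) sym_iso)" for v
    using assms by (auto simp: symmetric_state_def density_operator_def psd_def range_sym_iso)
  show "cadjoint (sym_restrict \<rho>) = sym_restrict \<rho>"
    by (simp add: sym_restrict_def cadjoint_mult psd(1) matrix_mul_assoc)
  have "cinner f (sym_restrict \<rho> *v f) = cinner (sym_iso *v f) (\<rho> *v (sym_iso *v f))"
    by (simp add: sym_restrict_def cinner_cadjoint[of "sym_iso *v f"] cinner_cadjoint[of f] matrix_vector_mul_assoc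
        cadjoint_mult matrix_mul_assoc)
  then show "0 \<le> Re (cinner f (sym_restrict \<rho> *v f))" using psd(2) by simp
  \<comment> \<open>The range of \<open>\<rho>\<close> is symmetric, so the projector onto the
    symmetric subspace fixes \<open>\<rho>\<close>; cyclicity of the trace then transfers the
    trace.\<close>
  have "(sym_iso ** cadjoint sym_iso ** \<rho>) *v v = \<rho> *v v" for v
  proof -
    obtain w where w: "\<rho> *v v = sym_iso *v w" using sym[of v] by blast
    have "(sym_iso ** cadjoint sym_iso ** \<rho>) *v v = (sym_iso ** (cadjoint sym_iso ** sym_iso)) *v w"
      by (simp only: w matrix_vector_mul_assoc[symmetric])
    then show ?thesis by (simp add: sym_iso_isometry w)
  qed
  then have "sym_iso ** (cadjoint sym_iso ** \<rho>) = \<rho>" by (simp add: matrix_eq matrix_mul_assoc)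
  then show "trace (sym_restrict \<rho>) = 1"
    using trace_mult_commute[of "cadjoint sym_iso ** \<rho>" sym_iso] tr by (simp add: sym_restrict_def)
qed

section \<open>Trace and expectations from a diagonalization\<close>

lemma conjugate_cadjoint:
  assumes "V \<in> special_unitary" "V ** A ** cadjoint V = D"
  shows "A = cadjoint V ** D ** V"
proof -
  have "cadjoint V ** V = mat 1" using assms by (simp add: special_unitary_def)
  then show ?thesis
    unfolding assms(2)[symmetric] by (metis matrix_mul_assoc matrix_mul_lid matrix_mul_rid)
qed

lemma trace_diagonalized:
  assumes "V \<in> special_unitary" "V ** A ** cadjoint V = diag3 a b c"
  shows "trace A = of_real (a + b + c)"
proof -
  have V: "cadjoint V ** V = mat 1" using assms by (simp add: special_unitary_def)
  have "trace (diag3 a b c) = trace (cadjoint V ** (V ** A))"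
    by (simp only: assms(2)[symmetric] trace_mult_commute[of "V ** A"])
  also have "\<dots> = trace A" by (simp add: matrix_mul_assoc V)
  finally show ?thesis by (simp add: trace_def diag3_def sum_3)
qed

lemma expectation_diagonalized:
  assumes V: "V \<in> special_unitary" "V ** A ** cadjoint V = diag3 a b c"
  shows "Re (cinner f (A *v f)) =
    a * (cmod ((V *v f) $ 1))\<^sup>2 + b * (cmod ((V *v f) $ 2))\<^sup>2 + c * (cmod ((V *v f) $ 3))\<^sup>2"
proof -
  have "cinner f (A *v f) = cinner (V *v f) (diag3 a b c *v (V *v f))"
    unfolding conjugate_cadjoint[OF V]
    by (simp add: cinner_cadjoint[of f] cinner_cadjoint[of "V *v f"] matrix_vector_mul_assoc cadjoint_mult matrix_mul_assoc)
  moreover have "Re (cinner g (diag3 a b c *v g)) =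
      a * (cmod (g $ 1))\<^sup>2 + b * (cmod (g $ 2))\<^sup>2 + c * (cmod (g $ 3))\<^sup>2" for g
    unfolding cmod_power2
    by (simp add: cinner_def matrix_vector_mult_def diag3_def sum_3 power2_eq_square algebra_simps)
  ultimately show ?thesis by simp
qed

lemma norm_squared_3:
  fixes g :: "complex^3"
  shows "(norm g)\<^sup>2 = (cmod (g $ 1))\<^sup>2 + (cmod (g $ 2))\<^sup>2 + (cmod (g $ 3))\<^sup>2"
  by (simp add: norm_vec_def L2_set_def sum_3)

text \<open>The expectation is an average of the eigenvalues with weights the squared moduli of the
  coordinates of \<open>V *v f\<close>.\<close>

lemma expectation_bounds:
  assumes V: "V \<in> special_unitary" "V ** A ** cadjoint V = diag3 a b c"
    and "a \<ge> b" "b \<ge> c" and f: "norm f = 1"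
  shows "c \<le> Re (cinner f (A *v f)) \<and> Re (cinner f (A *v f)) \<le> a"
proof -
  define x y z where "x = (cmod ((V *v f) $ 1))\<^sup>2" and "y = (cmod ((V *v f) $ 2))\<^sup>2" and "z = (cmod ((V *v f) $ 3))\<^sup>2"
  have "x + y + z = 1"
    using norm_squared_3[of "V *v f"] f by (simp add: x_def y_def z_def special_unitary_norm[OF V(1)])
  have "0 \<le> x" "0 \<le> y" "0 \<le> z" by (simp_all add: x_def y_def z_def)
  have e: "Re (cinner f (A *v f)) = a * x + b * y + c * z"
    unfolding expectation_diagonalized[OF V] x_def y_def z_def ..
  have "c * x \<le> a * x" "c * y \<le> b * y" "b * y \<le> a * y" "c * z \<le> a * z"
    using assms \<open>0 \<le> x\<close> \<open>0 \<le> y\<close> \<open>0 \<le> z\<close> by (auto intro: mult_right_mono)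
  moreover have "a * x + a * y + a * z = a" "c * x + c * y + c * z = c"
    using \<open>x + y + z = 1\<close> by (simp_all flip: distrib_left)
  ultimately show ?thesis unfolding e by linarith
qed

text \<open>The expression is the expectation of the partial transpose in the vector with
  coordinates \<open>\<alpha>\<close> at \<open>(1, 1)\<close> and \<open>- \<beta>\<close> at
  \<open>(2, 2)\<close>. It is real-linear in \<open>\<rho>\<close>, so nonnegativity passes from
  product projectors to their hull.\<close>

lemma separable_partial_transpose_witness:
  fixes \<alpha> \<beta> :: real
  assumes "separable \<rho>"
  shows "0 \<le> \<alpha>\<^sup>2 * Re (\<rho> $ (1, 1) $ (1, 1)) + \<beta>\<^sup>2 * Re (\<rho> $ (2, 2) $ (2, 2))
      - \<alpha> * \<beta> * (Re (\<rho> $ (1, 2) $ (2, 1)) + Re (\<rho> $ (2, 1) $ (1, 2)))" (is "0 \<le> ?w \<rho>")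
proof -
  have "convex {\<rho>. 0 \<le> ?w \<rho>}"
  proof (rule convexI)
    fix \<rho> \<sigma> :: two_qubit_op and u v :: real
    assume *: "\<rho> \<in> {\<rho>. 0 \<le> ?w \<rho>}" "\<sigma> \<in> {\<rho>. 0 \<le> ?w \<rho>}" "0 \<le> u" "0 \<le> v"
    have "?w (u *\<^sub>R \<rho> + v *\<^sub>R \<sigma>) = u * ?w \<rho> + v * ?w \<sigma>"
      by (simp add: algebra_simps)
    moreover have "0 \<le> u * ?w \<rho> + v * ?w \<sigma>"
      using * by (intro add_nonneg_nonneg mult_nonneg_nonneg) simp_all
    ultimately show "u *\<^sub>R \<rho> + v *\<^sub>R \<sigma> \<in> {\<rho>. 0 \<le> ?w \<rho>}" by (simp only: mem_Collect_eq)
  qed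
  moreover have "0 \<le> ?w (projector (tensor a b))" for a b
  proof -
    have "?w (projector (tensor a b)) = (cmod (of_real \<alpha> * a $ 1 * cnj (b $ 1) - of_real \<beta> * a $ 2 * cnj (b $ 2)))\<^sup>2"
      unfolding cmod_power2
      by (simp add: projector_def tensor_def power2_eq_square algebra_simps)
    then show ?thesis by simp
  qed
  ultimately have "convex hull {projector (tensor a b) | a b. norm a = 1 \<and> norm b = 1} \<subseteq> {\<rho>. 0 \<le> ?w \<rho>}"
    by (intro hull_minimal) auto
  then show ?thesis using assms unfolding separable_def by blast
qed

lemma sqrt_sum_ge_one_iff:
  fixes a b c :: real
  assumes "0 \<le> b" "0 \<le> c" "a + b + c = 1"
  shows "1 \<le> sqrt b + sqrt c \<longleftrightarrow> a \<le> 2 * sqrt (b * c)"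
proof -
  have "1 \<le> sqrt b + sqrt c \<longleftrightarrow> 1\<^sup>2 \<le> (sqrt b + sqrt c)\<^sup>2"
    using abs_le_square_iff[of 1 "sqrt b + sqrt c"] assms by simp
  also have "\<dots> \<longleftrightarrow> a \<le> 2 * sqrt (b * c)"
  proof -
    have "a = 1 - b - c" using assms by simp
    moreover have "(sqrt b + sqrt c)\<^sup>2 = b + c + 2 * sqrt (b * c)"
      using assms by (simp add: power2_sum real_sqrt_mult)
    ultimately show ?thesis by auto
  qed
  finally show ?thesis .
qed

theorem corollary1:
  fixes \<rho> :: two_qubit_op and \<tau>\<^sub>1 \<tau>\<^sub>2 \<tau>\<^sub>3 :: real
  assumes state: "symmetric_state \<rho>"
    and spectrum: "eigenvalues (sym_restrict \<rho>) =
          {#complex_of_real \<tau>\<^sub>1, complex_of_real \<tau>\<^sub>2, complex_of_real \<tau>\<^sub>3#}"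
    and ordered: "\<tau>\<^sub>1 \<ge> \<tau>\<^sub>2" "\<tau>\<^sub>2 \<ge> \<tau>\<^sub>3"
  shows "symmetric_absolutely_separable \<rho> \<longleftrightarrow> sqrt \<tau>\<^sub>2 + sqrt \<tau>\<^sub>3 \<ge> 1"
proof -
  define A where "A = sym_restrict \<rho>"
  note A = symmetric_state_sym_restrict[OF state, folded A_def]
  obtain V where V: "V \<in> special_unitary" "V ** A ** cadjoint V = diag3 \<tau>\<^sub>1 \<tau>\<^sub>2 \<tau>\<^sub>3"
    using special_unitary_diagonalization[OF A(1)] spectrum unfolding A_def by blast
  have sum: "\<tau>\<^sub>1 + \<tau>\<^sub>2 + \<tau>\<^sub>3 = 1"
    using trace_diagonalized[OF V] A(2) by (metis of_real_eq_1_iff)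
  have pos: "0 \<le> \<tau>\<^sub>3"
  proof -
    \<comment> \<open>The smallest eigenvalue is the expectation at its eigenvector, the adjoint
      image of the third axis.\<close>
    have "V *v (cadjoint V *v axis 3 1) = axis 3 1"
      using special_unitary_cadjoint[OF V(1)] by (simp add: matrix_vector_mul_assoc special_unitary_def)
    then show ?thesis
      using A(3)[of "cadjoint V *v axis 3 1"] unfolding expectation_diagonalized[OF V] by (simp add: axis_def)
  qed
  have criterion: "sqrt \<tau>\<^sub>2 + sqrt \<tau>\<^sub>3 \<ge> 1 \<longleftrightarrow> \<tau>\<^sub>1 \<le> 2 * sqrt (\<tau>\<^sub>2 * \<tau>\<^sub>3)"
    using sqrt_sum_ge_one_iff[of \<tau>\<^sub>2 \<tau>\<^sub>3 \<tau>\<^sub>1] pos ordered sum by simp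
  have middle: "1 - \<tau>\<^sub>1 - \<tau>\<^sub>3 = \<tau>\<^sub>2" using sum by simp
  have t1: "0 < \<tau>\<^sub>1" using pos ordered sum by simp
  show ?thesis
  proof
    assume sas: "symmetric_absolutely_separable \<rho>"
    \<comment> \<open>The largest eigenvalue is placed on the middle Dicke vector, the entangled one
      of the basis.\<close>
    obtain U where U: "U \<in> special_unitary" "U ** A ** cadjoint U = diag3 \<tau>\<^sub>3 \<tau>\<^sub>1 \<tau>\<^sub>2"
      using special_unitary_diagonalization[OF A(1), of \<tau>\<^sub>3 \<tau>\<^sub>1 \<tau>\<^sub>2] spectrum
      unfolding A_def by (auto simp: add_mset_commute)
    then have sep: "separable (sym_lift (diag3 \<tau>\<^sub>3 \<tau>\<^sub>1 \<tau>\<^sub>2))"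
      using sas unfolding symmetric_absolutely_separable_def sym_lift_conjugate A_def by metis
    have entries: "Re (sym_lift (diag3 \<tau>\<^sub>3 \<tau>\<^sub>1 \<tau>\<^sub>2) $ (1, 1) $ (1, 1)) = \<tau>\<^sub>3"
      "Re (sym_lift (diag3 \<tau>\<^sub>3 \<tau>\<^sub>1 \<tau>\<^sub>2) $ (2, 2) $ (2, 2)) = \<tau>\<^sub>2"
      "Re (sym_lift (diag3 \<tau>\<^sub>3 \<tau>\<^sub>1 \<tau>\<^sub>2) $ (1, 2) $ (2, 1)) = (\<tau>\<^sub>1 / 2)"
      "Re (sym_lift (diag3 \<tau>\<^sub>3 \<tau>\<^sub>1 \<tau>\<^sub>2) $ (2, 1) $ (1, 2)) = (\<tau>\<^sub>1 / 2)"
      unfolding sym_lift_entry by (simp_all add: sum_3 sym_iso_entries diag3_def complex_eq_iff)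
    then have w: "0 \<le> \<alpha>\<^sup>2 * \<tau>\<^sub>3 + \<beta>\<^sup>2 * \<tau>\<^sub>2 - \<alpha> * \<beta> * \<tau>\<^sub>1" for \<alpha> \<beta>
      using separable_partial_transpose_witness[OF sep, of \<alpha> \<beta>] unfolding entries by simp
    have "\<tau>\<^sub>3 \<noteq> 0"
    proof
      assume "\<tau>\<^sub>3 = 0"
      \<comment> \<open>This choice makes the witness
        \<open>\<tau>\<^sub>2 - (\<tau>\<^sub>2 + 1)\<close>, which is -1.\<close>
      then show False using w[of "(\<tau>\<^sub>2 + 1) / \<tau>\<^sub>1" 1] t1 by simp
    qed
    then have t: "0 < \<tau>\<^sub>2 * \<tau>\<^sub>3" using pos ordered by simp
    \<comment> \<open>These \<open>\<alpha>\<close> and \<open>\<beta>\<close> make both square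
      terms equal to \<open>\<tau>\<^sub>2 * \<tau>\<^sub>3\<close>; the common positive root then
      cancels.\<close>
    have "sqrt (\<tau>\<^sub>2 * \<tau>\<^sub>3) * \<tau>\<^sub>1 \<le> 2 * (\<tau>\<^sub>2 * \<tau>\<^sub>3)"
      using w[of "sqrt \<tau>\<^sub>2" "sqrt \<tau>\<^sub>3"] pos ordered by (simp add: real_sqrt_mult)
    also have "\<dots> = sqrt (\<tau>\<^sub>2 * \<tau>\<^sub>3) * (2 * sqrt (\<tau>\<^sub>2 * \<tau>\<^sub>3))" using t by simp
    finally show "sqrt \<tau>\<^sub>2 + sqrt \<tau>\<^sub>3 \<ge> 1" using t by (simp add: criterion)
  next
    assume "sqrt \<tau>\<^sub>2 + sqrt \<tau>\<^sub>3 \<ge> 1"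
    then have "\<tau>\<^sub>1 \<le> 2 * sqrt (\<tau>\<^sub>2 * \<tau>\<^sub>3)" by (simp add: criterion)
    then have "\<tau>\<^sub>1\<^sup>2 \<le> (2 * sqrt (\<tau>\<^sub>2 * \<tau>\<^sub>3))\<^sup>2" using t1 by (intro power_mono) auto
    then have t: "\<tau>\<^sub>1\<^sup>2 \<le> 4 * \<tau>\<^sub>3 * \<tau>\<^sub>2" using pos ordered by (simp add: power_mult_distrib mult_ac)
    have "separable (sym_lift (U ** A ** cadjoint U))" if U: "U \<in> special_unitary" for U
    proof (rule separable_sym_lift)
      \<comment> \<open>\<open>W\<close> diagonalizes the conjugated state to the same matrix, so
        the eigenvalue bounds hold for every \<open>U\<close>.\<close>
      define W where "W = V ** cadjoint U"
      have UU: "cadjoint U ** U = mat 1" using U by (simp add: special_unitary_def)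
      have W: "W \<in> special_unitary"
        by (simp add: W_def special_unitary_mult special_unitary_cadjoint U V(1))
      have "W ** (U ** A ** cadjoint U) ** cadjoint W
          = V ** (cadjoint U ** U) ** A ** (cadjoint U ** U) ** cadjoint V"
        by (simp add: W_def cadjoint_mult matrix_mul_assoc)
      then have D: "W ** (U ** A ** cadjoint U) ** cadjoint W = diag3 \<tau>\<^sub>1 \<tau>\<^sub>2 \<tau>\<^sub>3"
        by (simp add: UU V(2))
      show "cadjoint (U ** A ** cadjoint U) = U ** A ** cadjoint U"
        by (simp add: cadjoint_mult A(1) matrix_mul_assoc)
      show "trace (U ** A ** cadjoint U) = 1"
        using trace_diagonalized[OF W D] sum by simp
      show "\<tau>\<^sub>3 \<le> Re (cinner f (U ** A ** cadjoint U *v f)) \<and> Re (cinner f (U ** A ** cadjoint U *v f)) \<le> \<tau>\<^sub>1"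
        if "norm f = 1" for f
        by (rule expectation_bounds[OF W D ordered that])
    qed (use pos ordered t middle in simp_all)
    then show "symmetric_absolutely_separable \<rho>"
      unfolding symmetric_absolutely_separable_def sym_lift_conjugate A_def by blast
  qed
qed

end
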